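(* Let $D=V(f)$ be a germ of strongly Saito-holonomic divisor in $(\mathbb{C}^n,0)$. If the ideal $\ker^{(1)}\varphi$ is unmixed (that is, all its associated primes have the same height), then $D$ is of linear Jacobian type.
   Context: A divisor is a reduced complex hypersurface; $f\in\mathcal{O}=\mathbb{C}\{x_1,\dots,x_n\}$ is a reduced equation of $D$. Let $\{\delta_1,\dots,\delta_m\}$ be a generating set of the $\mathcal{O}$-module of $\mathbb{C}$-derivations $\delta$ of $\mathcal{O}$ with $\delta(f)\in(f)$; write $\delta_i(f)=\alpha_i f$, and for $\delta=\sum_j a_j\partial_j$ let $\sigma(\delta)=\sum_j a_j\xi_j\in\mathcal{O}[\xi_1,\dots,\xi_n]$ be its principal symbol. Strong Saito-holonomicity: $D$ is strongly Saito-holonomic at $0$ if the ideal $(f,\sigma(\delta_1)-\alpha_1 s,\dots,\sigma(\delta_m)-\alpha_m s)$ has height $n+1$ in $\mathcal{O}[\xi_1,\dots,\xi_n,s]$; this is independent of choices, and if it holds at $0$ the analogous condition holds at all points of $D$ near $0$. Linear Jacobian type: let $\mathcal{J}_f=(\partial_1(f),\dots,\partial_n(f),f)\subset\mathcal{O}$, let $\mathcal{R}(\mathcal{J}_f)=\bigoplus_{i\ge0}\mathcal{J}_f^i t^i$ be its Rees algebra, and let $\varphi:\mathcal{O}[\xi_1,\dots,\xi_n,s]\to\mathcal{R}(\mathcal{J}_f)$ be the graded $\mathcal{O}$-algebra map with $\xi_i\mapsto\partial_i(f)t$, $s\mapsto ft$. Let $\ker^{(1)}\varphi$ be the ideal of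 $\mathcal{O}[\xi_1,\dots,\xi_n,s]$ generated by the degree-one homogeneous part of $\ker\varphi$ (degree in $\xi_1,\dots,\xi_n,s$), that is, the ideal generated by $\sigma(\delta_i)-\alpha_i s$, $i=1,\dots,m$. $D$ is of linear Jacobian type if $\ker\varphi=\ker^{(1)}\varphi$. *)

theory Defs
  imports
    "HOL-Analysis.Infinite_Sum"
    "HOL-Library.Poly_Mapping"
    "HOL-Library.Extended_Nat"
    "HOL-Library.Cardinality"
    "HOL-Computational_Algebra.Polynomial"
    "HOL-Algebra.Ideal_Product"
    "HOL-Algebra.RingHom"
    "HOL-Algebra.Algebraic_Closure_Type"
begin

section \<open>Convergent power series\<close>

text \<open>Exponent vectors of monomials in the variables indexed by \<open>'v\<close>.\<close>

type_synonym 'v mexp = "'v \<Rightarrow>\<^sub>0 nat"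

definition mdeg :: "('v::finite) mexp \<Rightarrow> nat" where
  "mdeg a = (\<Sum>i\<in>UNIV. Poly_Mapping.lookup a i)"

lemma mdeg_zero [simp]: "mdeg 0 = 0"
  and mdeg_add: "mdeg (a + b) = mdeg a + mdeg b"
  and mdeg_single [simp]: "mdeg (Poly_Mapping.single i k) = k"
  by (auto simp: mdeg_def lookup_add sum.distrib lookup_single when_def)

definition antidiag :: "('v::finite) mexp \<Rightarrow> ('v mexp \<times> 'v mexp) set" where
  "antidiag d = {(a, b). a + b = d}"

lemma finite_antidiag [simp, intro]: "finite (antidiag (d :: ('v::finite) mexp))"
proof -
  let ?L = "Poly_Mapping.lookup :: 'v mexp \<Rightarrow> 'v \<Rightarrow> nat"
  let ?S = "{a. \<forall>i. ?L a i \<le> ?L d i}"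
  have "?L ` ?S \<subseteq> Pi\<^sub>E UNIV (\<lambda>i. {..?L d i})"
    by auto
  moreover have "finite (Pi\<^sub>E UNIV (\<lambda>i. {..?L d i}))"
    by (intro finite_PiE) auto
  ultimately have "finite (?L ` ?S)"
    by (rule finite_subset)
  moreover have "inj_on ?L ?S"
    by (auto simp: inj_on_def poly_mapping_eqI)
  ultimately have "finite ?S"
    by (rule finite_imageD)
  moreover have "antidiag d \<subseteq> ?S \<times> ?S"
    by (auto simp: antidiag_def lookup_add)
  ultimately show ?thesis
    by (meson finite_SigmaI finite_subset)
qed

text \<open>The series with coefficients \<open>c\<close> lies in \<open>\<complex>{x\<^sub>1,\<dots>,x\<^sub>n}\<close> iff it converges absolutely
  at some point \<open>(r,\<dots>,r)\<close> with \<open>r > 0\<close>, hence on the polydisc of radius \<open>r\<close>.\<close>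

definition conv_series :: "(('v::finite) mexp \<Rightarrow> complex) \<Rightarrow> bool" where
  "conv_series c \<longleftrightarrow> (\<exists>r>0. (\<lambda>a. norm (c a) * r ^ mdeg a) summable_on UNIV)"

lemma conv_seriesI:
  assumes "r > 0" "\<And>F. finite F \<Longrightarrow> (\<Sum>a\<in>F. norm (c a) * r ^ mdeg a) \<le> B"
  shows "conv_series c"
  unfolding conv_series_def
  using assms by (intro exI[of _ r] conjI nonneg_bdd_above_summable_on bdd_aboveI2[where M = B]) auto

lemma conv_seriesE:
  assumes "conv_series c"
  obtains r B where "r > 0" "\<And>s F. 0 \<le> s \<Longrightarrow> s \<le> r \<Longrightarrow> finite F \<Longrightarrow> (\<Sum>a\<in>F. norm (c a) * s ^ mdeg a) \<le> B"
proof -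
  from assms obtain r where r: "r > 0" "(\<lambda>a. norm (c a) * r ^ mdeg a) summable_on UNIV"
    by (auto simp: conv_series_def)
  show thesis
  proof (rule that[OF r(1)])
    fix s F assume s: "0 \<le> s" "s \<le> r" "finite (F :: 'a mexp set)"
    have "(\<Sum>a\<in>F. norm (c a) * s ^ mdeg a) \<le> (\<Sum>a\<in>F. norm (c a) * r ^ mdeg a)"
      using s by (intro sum_mono mult_left_mono power_mono) auto
    also have "\<dots> \<le> infsum (\<lambda>a. norm (c a) * r ^ mdeg a) UNIV"
      using s r by (intro finite_sum_le_infsum) auto
    finally show "(\<Sum>a\<in>F. norm (c a) * s ^ mdeg a) \<le> infsum (\<lambda>a. norm (c a) * r ^ mdeg a) UNIV" .
  qed
qed

lemma conv_series_single: "conv_series (\<lambda>a. if a = d then z else 0)"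
proof (rule conv_seriesI[of 1])
  fix F :: "'a mexp set" assume F: "finite F"
  have "(\<Sum>a\<in>F. norm (if a = d then z else 0) * 1 ^ mdeg a) = (\<Sum>a\<in>F. if a = d then norm z else 0)"
    by (intro sum.cong) auto
  also have "\<dots> \<le> norm z"
    using F by simp
  finally show "(\<Sum>a\<in>F. norm (if a = d then z else 0) * 1 ^ mdeg a) \<le> norm z" .
qed auto

lemma conv_series_add:
  assumes "conv_series f" "conv_series g"
  shows "conv_series (\<lambda>a. f a + g a)"
proof -
  from conv_seriesE[OF assms(1)] obtain r B
    where r: "r > 0" "\<And>s F. 0 \<le> s \<Longrightarrow> s \<le> r \<Longrightarrow> finite F \<Longrightarrow> (\<Sum>a\<in>F. norm (f a) * s ^ mdeg a) \<le> B"
    by metis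
  from conv_seriesE[OF assms(2)] obtain t C
    where t: "t > 0" "\<And>s F. 0 \<le> s \<Longrightarrow> s \<le> t \<Longrightarrow> finite F \<Longrightarrow> (\<Sum>a\<in>F. norm (g a) * s ^ mdeg a) \<le> C"
    by metis
  let ?s = "min r t"
  show ?thesis
  proof (rule conv_seriesI[of ?s _ "B + C"])
    fix F :: "'a mexp set" assume F: "finite F"
    have "(\<Sum>a\<in>F. norm (f a + g a) * ?s ^ mdeg a)
        \<le> (\<Sum>a\<in>F. norm (f a) * ?s ^ mdeg a + norm (g a) * ?s ^ mdeg a)"
      using r(1) t(1) by (intro sum_mono) (auto simp flip: distrib_right intro!: mult_right_mono norm_triangle_ineq)
    also have "\<dots> \<le> B + C"
      unfolding sum.distrib using r t F by (intro add_mono) auto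
    finally show "(\<Sum>a\<in>F. norm (f a + g a) * ?s ^ mdeg a) \<le> B + C" .
  qed (use r t in auto)
qed

lemma conv_series_uminus: "conv_series f \<Longrightarrow> conv_series (\<lambda>a. - f a)"
  by (simp add: conv_series_def)

lemma conv_series_mult:
  assumes "conv_series f" "conv_series g"
  shows "conv_series (\<lambda>d. \<Sum>(a, b)\<in>antidiag d. f a * g b)"
proof -
  from conv_seriesE[OF assms(1)] obtain r B
    where r: "r > 0" "\<And>s F. 0 \<le> s \<Longrightarrow> s \<le> r \<Longrightarrow> finite F \<Longrightarrow> (\<Sum>a\<in>F. norm (f a) * s ^ mdeg a) \<le> B"
    by metis
  from conv_seriesE[OF assms(2)] obtain t C
    where t: "t > 0" "\<And>s F. 0 \<le> s \<Longrightarrow> s \<le> t \<Longrightarrow> finite F \<Longrightarrow> (\<Sum>a\<in>F. norm (g a) * s ^ mdeg a) \<le> C"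
    by metis
  define s where "s = min r t"
  have s: "s > 0" "s \<le> r" "s \<le> t" using r t by (auto simp: s_def)
  have B: "B \<ge> 0" using r(2)[of s "{}"] s by simp
  show ?thesis
  proof (rule conv_seriesI[of s _ "B * C"])
    fix F :: "'a mexp set" assume F: "finite F"
    define G where "G = Sigma F antidiag"
    have G: "finite G" using F by (auto simp: G_def)
    let ?f = "\<lambda>a. norm (f a) * s ^ mdeg a" and ?g = "\<lambda>a. norm (g a) * s ^ mdeg a"
    have "(\<Sum>d\<in>F. norm (\<Sum>(a, b)\<in>antidiag d. f a * g b) * s ^ mdeg d)
        \<le> (\<Sum>d\<in>F. \<Sum>(a, b)\<in>antidiag d. ?f a * ?g b)"
    proof (rule sum_mono)
      fix d
      have "norm (\<Sum>(a, b)\<in>antidiag d. f a * g b) * s ^ mdeg d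
          \<le> (\<Sum>(a, b)\<in>antidiag d. norm (f a * g b)) * s ^ mdeg d"
        using s by (intro mult_right_mono) (auto simp: case_prod_unfold intro: norm_sum)
      also have "\<dots> = (\<Sum>(a, b)\<in>antidiag d. ?f a * ?g b)"
        unfolding sum_distrib_right
        by (intro sum.cong) (auto simp: antidiag_def mdeg_add power_add norm_mult)
      finally show "norm (\<Sum>(a, b)\<in>antidiag d. f a * g b) * s ^ mdeg d
          \<le> (\<Sum>(a, b)\<in>antidiag d. ?f a * ?g b)" .
    qed
    also have "\<dots> = (\<Sum>(d, a, b)\<in>G. ?f a * ?g b)"
      unfolding G_def using F by (subst sum.Sigma) auto
    also have "\<dots> = (\<Sum>(a, b)\<in>snd ` G. ?f a * ?g b)"
      by (rule sum.reindex_cong[of snd, symmetric, OF _ refl])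
         (auto simp: inj_on_def G_def antidiag_def)
    also have "\<dots> \<le> (\<Sum>(a, b)\<in>(fst ` snd ` G) \<times> (snd ` snd ` G). ?f a * ?g b)"
      using G s by (intro sum_mono2) (force simp: image_iff)+
    also have "\<dots> = (\<Sum>a\<in>fst ` snd ` G. ?f a) * (\<Sum>b\<in>snd ` snd ` G. ?g b)"
      by (simp add: sum_product sum.cartesian_product)
    also have "\<dots> \<le> B * C"
      using s B G by (intro mult_mono r t sum_nonneg) auto
    finally show "(\<Sum>d\<in>F. norm (\<Sum>(a, b)\<in>antidiag d. f a * g b) * s ^ mdeg d) \<le> B * C" .
  qed (use s in auto)
qed

lemma conv_series_deriv:
  assumes "conv_series f"
  shows "conv_series (\<lambda>a. of_nat (Suc (Poly_Mapping.lookup a j)) * f (a + Poly_Mapping.single j 1))"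
proof -
  from conv_seriesE[OF assms(1)] obtain r B
    where r: "r > 0" "\<And>s F. 0 \<le> s \<Longrightarrow> s \<le> r \<Longrightarrow> finite F \<Longrightarrow> (\<Sum>a\<in>F. norm (f a) * s ^ mdeg a) \<le> B"
    by metis
  show ?thesis
  proof (rule conv_seriesI[of "r / 2" _ "B * (2 / r)"])
    fix F :: "'a mexp set" assume F: "finite F"
    let ?e = "\<lambda>a. a + Poly_Mapping.single j (1::nat)"
    have "(\<Sum>a\<in>F. norm (of_nat (Suc (Poly_Mapping.lookup a j)) * f (?e a)) * (r / 2) ^ mdeg a)
        \<le> (\<Sum>a\<in>F. norm (f (?e a)) * r ^ mdeg (?e a) * (2 / r))"
    proof (rule sum_mono)
      fix a :: "'a mexp"
      have "Poly_Mapping.lookup a j \<le> mdeg a"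
        unfolding mdeg_def by (rule member_le_sum) auto
      also have "\<dots> < 2 ^ mdeg a" by simp
      finally have "real (Suc (Poly_Mapping.lookup a j)) \<le> 2 ^ mdeg a"
        by (metis Suc_leI of_nat_le_iff of_nat_numeral of_nat_power)
      hence "real (Suc (Poly_Mapping.lookup a j)) \<le> 2 * 2 ^ mdeg a"
        by (smt (verit) zero_le_power)
      hence *: "real (Suc (Poly_Mapping.lookup a j)) * (norm (f (?e a)) * (r / 2) ^ mdeg a)
          \<le> 2 * 2 ^ mdeg a * (norm (f (?e a)) * (r / 2) ^ mdeg a)"
        using r(1) by (intro mult_right_mono) auto
      have eq: "2 * 2 ^ mdeg a * (norm (f (?e a)) * (r / 2) ^ mdeg a)
          = norm (f (?e a)) * r ^ mdeg (?e a) * (2 / r)"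
        using r(1) by (simp add: mdeg_add power_divide field_simps)
      show "norm (of_nat (Suc (Poly_Mapping.lookup a j)) * f (?e a)) * (r / 2) ^ mdeg a
          \<le> norm (f (?e a)) * r ^ mdeg (?e a) * (2 / r)"
        using * unfolding eq by (simp only: norm_mult norm_of_nat mult.assoc)
    qed
    also have "\<dots> = (\<Sum>a\<in>?e ` F. norm (f a) * r ^ mdeg a) * (2 / r)"
      by (simp only: sum_distrib_right[symmetric]) (subst sum.reindex, auto simp: inj_on_def)
    also have "\<dots> \<le> B * (2 / r)"
      using r F by (intro mult_right_mono) auto
    finally show "(\<Sum>a\<in>F. norm (of_nat (Suc (Poly_Mapping.lookup a j)) * f (?e a)) * (r / 2) ^ mdeg a)
        \<le> B * (2 / r)" .
  qed (use r in auto)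
qed

text \<open>The ring \<open>\<O> = \<complex>{x\<^sub>1,\<dots>,x\<^sub>n}\<close>, with variables indexed by a finite type \<open>'n\<close>, \<open>n = CARD('n)\<close>.\<close>

typedef (overloaded) ('n::finite) cps = "{c :: 'n mexp \<Rightarrow> complex. conv_series c}"
  morphisms cps_coeff Abs_cps
  using conv_series_single[of 0 0] by blast

setup_lifting type_definition_cps

lemma cps_eqI: "(\<And>a. cps_coeff f a = cps_coeff g a) \<Longrightarrow> f = g"
  by transfer auto

instantiation cps :: (finite) comm_ring_1
begin

lift_definition zero_cps :: "'a cps" is "\<lambda>_. 0"
  using conv_series_single[of 0 0] by simp

lift_definition one_cps :: "'a cps" is "\<lambda>a. if a = 0 then 1 else 0"
  by (rule conv_series_single)

lift_definition plus_cps :: "'a cps \<Rightarrow> 'a cps \<Rightarrow> 'a cps" is "\<lambda>f g a. f a + g a"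
  by (rule conv_series_add)

lift_definition uminus_cps :: "'a cps \<Rightarrow> 'a cps" is "\<lambda>f a. - f a"
  by (rule conv_series_uminus)

lift_definition minus_cps :: "'a cps \<Rightarrow> 'a cps \<Rightarrow> 'a cps" is "\<lambda>f g a. f a - g a"
  using conv_series_add[OF _ conv_series_uminus] by fastforce

lift_definition times_cps :: "'a cps \<Rightarrow> 'a cps \<Rightarrow> 'a cps"
  is "\<lambda>f g d. \<Sum>(a, b)\<in>antidiag d. f a * g b"
  by (rule conv_series_mult)

instance
proof
  fix f g h :: "'a cps"
  show "f * g * h = f * (g * h)"
  proof (transfer, rule ext)
    fix f g h :: "'a mexp \<Rightarrow> complex" and d
    have "(\<Sum>(a, b)\<in>antidiag d. (\<Sum>(p, q)\<in>antidiag a. f p * g q) * h b)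
        = (\<Sum>x\<in>antidiag d. \<Sum>y\<in>antidiag (fst x). f (fst y) * g (snd y) * h (snd x))"
      by (simp add: case_prod_unfold sum_distrib_right)
    also have "\<dots> = (\<Sum>(x, y)\<in>Sigma (antidiag d) (\<lambda>x. antidiag (fst x)). f (fst y) * g (snd y) * h (snd x))"
      by (rule sum.Sigma) auto
    also have "\<dots> = (\<Sum>(x, y)\<in>Sigma (antidiag d) (\<lambda>x. antidiag (snd x)). f (fst x) * (g (fst y) * h (snd y)))"
      by (rule sum.reindex_bij_witness[where
            i = "\<lambda>(x, y). ((fst x + fst y, snd y), (fst x, fst y))" and
            j = "\<lambda>(x, y). ((fst y, snd y + snd x), (snd y, snd x))"])
         (auto simp: antidiag_def add_ac)
    also have "\<dots> = (\<Sum>x\<in>antidiag d. \<Sum>y\<in>antidiag (snd x). f (fst x) * (g (fst y) * h (snd y)))"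
      by (rule sum.Sigma[symmetric]) auto
    also have "\<dots> = (\<Sum>(a, b)\<in>antidiag d. f a * (\<Sum>(p, q)\<in>antidiag b. g p * h q))"
      by (simp add: case_prod_unfold sum_distrib_left)
    finally show "(\<Sum>(a, b)\<in>antidiag d. (\<Sum>(p, q)\<in>antidiag a. f p * g q) * h b)
        = (\<Sum>(a, b)\<in>antidiag d. f a * (\<Sum>(p, q)\<in>antidiag b. g p * h q))" .
  qed
  show "f * g = g * f"
  proof (transfer, rule ext)
    fix f g :: "'a mexp \<Rightarrow> complex" and d
    show "(\<Sum>(a, b)\<in>antidiag d. f a * g b) = (\<Sum>(a, b)\<in>antidiag d. g a * f b)"
      by (rule sum.reindex_bij_witness[where i = prod.swap and j = prod.swap])
         (auto simp: antidiag_def add_ac)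
  qed
  show "1 * f = f"
  proof (transfer, rule ext)
    fix f :: "'a mexp \<Rightarrow> complex" and d
    have "(\<Sum>(a, b)\<in>antidiag d. (if a = 0 then 1 else 0) * f b) = (\<Sum>(a, b)\<in>{(0 :: 'a mexp, d)}. f b)"
      by (rule sum.mono_neutral_cong_right[OF finite_antidiag]) (auto simp: antidiag_def split: if_splits)
    thus "(\<Sum>(a, b)\<in>antidiag d. (if a = 0 then 1 else 0) * f b) = f d" by simp
  qed
  show "(f + g) * h = f * h + g * h"
    by transfer (auto simp: case_prod_unfold distrib_right sum.distrib)
  show "(0::'a cps) \<noteq> 1"
    by transfer (auto simp: fun_eq_iff)
qed (transfer; auto simp: fun_eq_iff; fail)+

end

lift_definition cps_const :: "complex \<Rightarrow> ('n::finite) cps" is "\<lambda>z a. if a = 0 then z else 0"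
  by (rule conv_series_single)

lift_definition cps_var :: "'n \<Rightarrow> ('n::finite) cps"
  is "\<lambda>j a. if a = Poly_Mapping.single j 1 then 1 else 0"
  by (rule conv_series_single)

lift_definition cps_deriv :: "'n \<Rightarrow> ('n::finite) cps \<Rightarrow> 'n cps"
  is "\<lambda>j f a. of_nat (Suc (Poly_Mapping.lookup a j)) * f (a + Poly_Mapping.single j 1)"
  by (rule conv_series_deriv)

lemma cps_deriv_var: "cps_deriv j (cps_var i) = (if i = j then 1 else 0)"
proof -
  have "a + Poly_Mapping.single j 1 = Poly_Mapping.single i 1 \<longleftrightarrow> i = j \<and> a = 0"
    for a :: "'a mexp"
  proof
    assume *: "a + Poly_Mapping.single j 1 = Poly_Mapping.single i (1::nat)"
    from arg_cong[OF this, of "\<lambda>m. Poly_Mapping.lookup m j"] have "i = j"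
      by (auto simp: lookup_add lookup_single when_def split: if_splits)
    with * show "i = j \<and> a = 0" by simp
  qed simp
  thus ?thesis
    by (intro cps_eqI) (auto simp: cps_deriv.rep_eq cps_var.rep_eq one_cps.rep_eq zero_cps.rep_eq)
qed

text \<open>A reduced equation of a germ of divisor in \<open>(\<complex>\<^sup>n, 0)\<close>: a nonzero non-unit of \<open>\<O>\<close>
  generating a radical ideal.\<close>

definition reduced_equation :: "('n::finite) cps \<Rightarrow> bool" where
  "reduced_equation f \<longleftrightarrow>
     f \<noteq> 0 \<and> cps_coeff f 0 = 0 \<and> (\<forall>g k. f dvd g ^ k \<longrightarrow> f dvd g)"


section \<open>Logarithmic derivations and their symbols\<close>

definition is_derivation :: "(('n::finite) cps \<Rightarrow> 'n cps) \<Rightarrow> bool" where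
  "is_derivation \<delta> \<longleftrightarrow>
     (\<forall>g h. \<delta> (g + h) = \<delta> g + \<delta> h) \<and>
     (\<forall>z g. \<delta> (cps_const z * g) = cps_const z * \<delta> g) \<and>
     (\<forall>g h. \<delta> (g * h) = g * \<delta> h + h * \<delta> g)"

definition log_derivations :: "('n::finite) cps \<Rightarrow> ('n cps \<Rightarrow> 'n cps) set" where
  "log_derivations f = {\<delta>. is_derivation \<delta> \<and> f dvd \<delta> f}"

definition generates_log_derivations ::
    "('n::finite) cps \<Rightarrow> nat \<Rightarrow> (nat \<Rightarrow> 'n cps \<Rightarrow> 'n cps) \<Rightarrow> bool" where
  "generates_log_derivations f m \<delta> \<longleftrightarrow>
     (\<forall>i<m. \<delta> i \<in> log_derivations f) \<and>
     (\<forall>\<eta>\<in>log_derivations f. \<exists>c. \<forall>g. \<eta> g = (\<Sum>i<m. c i * \<delta> i g))"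

text \<open>The polynomial ring \<open>\<O>[\<xi>\<^sub>1,\<dots>,\<xi>\<^sub>n,s]\<close>: the variable \<open>\<xi>\<^sub>j\<close> has index \<open>Some j\<close>
  and \<open>s\<close> has index \<open>None\<close>.\<close>

type_synonym 'n xis_poly = "('n option) mexp \<Rightarrow>\<^sub>0 'n cps"

definition PConst :: "('n::finite) cps \<Rightarrow> 'n xis_poly" where
  "PConst a = Poly_Mapping.single 0 a"

definition PVar :: "'n option \<Rightarrow> ('n::finite) xis_poly" where
  "PVar v = Poly_Mapping.single (Poly_Mapping.single v 1) 1"

abbreviation Pxi :: "'n \<Rightarrow> ('n::finite) xis_poly" where "Pxi j \<equiv> PVar (Some j)"
abbreviation Ps :: "('n::finite) xis_poly" where "Ps \<equiv> PVar None"

text \<open>For \<open>\<delta> = \<Sum>\<^sub>j a\<^sub>j \<partial>\<^sub>j\<close> one has \<open>a\<^sub>j = \<delta>(x\<^sub>j)\<close>; see the lemma below.\<close>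

definition symbol :: "(('n::finite) cps \<Rightarrow> 'n cps) \<Rightarrow> 'n xis_poly" where
  "symbol \<delta> = (\<Sum>j\<in>UNIV. PConst (\<delta> (cps_var j)) * Pxi j)"

lemma symbol_eq:
  "symbol (\<lambda>g. \<Sum>j\<in>UNIV. a j * cps_deriv j g) = (\<Sum>j\<in>UNIV. PConst (a j) * Pxi j)"
  by (simp add: symbol_def cps_deriv_var if_distrib cong: if_cong)


section \<open>Height and unmixedness\<close>

definition prime_height :: "('a, 'b) ring_scheme \<Rightarrow> 'a set \<Rightarrow> enat" where
  "prime_height R P =
     Sup {enat k | k C. (\<forall>i\<le>k. primeideal (C i) R) \<and> (\<forall>i<k. C i \<subset> C (Suc i)) \<and> C k = P}"

text \<open>The unit ideal has height \<open>\<infinity>\<close> (infimum of the empty set).\<close>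

definition ideal_height :: "('a, 'b) ring_scheme \<Rightarrow> 'a set \<Rightarrow> enat" where
  "ideal_height R I = Inf {prime_height R P | P. primeideal P R \<and> I \<subseteq> P}"

definition associated_primes :: "('a, 'b) ring_scheme \<Rightarrow> 'a set \<Rightarrow> 'a set set" where
  "associated_primes R I =
     {P. primeideal P R \<and> (\<exists>a\<in>carrier R. P = {r \<in> carrier R. r \<otimes>\<^bsub>R\<^esub> a \<in> I})}"

definition unmixed :: "('a, 'b) ring_scheme \<Rightarrow> 'a set \<Rightarrow> bool" where
  "unmixed R I \<longleftrightarrow>
     (\<forall>P\<in>associated_primes R I. \<forall>Q\<in>associated_primes R I. ideal_height R P = ideal_height R Q)"

abbreviation (input) xis_ring :: "('n::finite) xis_poly ring" where
  "xis_ring \<equiv> ring_of_type_algebra"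


section \<open>Strong Saito-holonomicity\<close>

text \<open>The condition does not depend on the generating family nor on the \<open>\<alpha> i\<close>.\<close>

definition strongly_Saito_holonomic :: "('n::finite) cps \<Rightarrow> bool" where
  "strongly_Saito_holonomic (f :: 'n cps) \<longleftrightarrow>
     (\<exists>m \<delta> \<alpha>. generates_log_derivations f m \<delta> \<and> (\<forall>i<m. \<delta> i f = \<alpha> i * f) \<and>
        ideal_height xis_ring
          (Idl\<^bsub>xis_ring\<^esub> (insert (PConst f) ((\<lambda>i. symbol (\<delta> i) - PConst (\<alpha> i) * Ps) ` {..<m})))
        = enat (CARD('n) + 1))"


section \<open>The Rees algebra and linear Jacobian type\<close>

definition jacobian_ideal :: "('n::finite) cps \<Rightarrow> 'n cps set" where
  "jacobian_ideal f = Idl\<^bsub>ring_of_type_algebra\<^esub> (insert f (range (\<lambda>j. cps_deriv j f)))"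

primrec ideal_power :: "('a, 'b) ring_scheme \<Rightarrow> 'a set \<Rightarrow> nat \<Rightarrow> 'a set" where
  "ideal_power R I 0 = carrier R"
| "ideal_power R I (Suc k) = ideal_prod R I (ideal_power R I k)"

text \<open>The Rees algebra \<open>\<Oplus>\<^sub>i J\<^sup>i t\<^sup>i\<close> as a subring of \<open>A[t]\<close>.\<close>

definition rees_algebra :: "('a::comm_ring_1) set \<Rightarrow> 'a poly ring" where
  "rees_algebra J =
     ring_of_type_algebra\<lparr>carrier := {p. \<forall>i. coeff p i \<in> ideal_power ring_of_type_algebra J i}\<rparr>"

fun rees_gen :: "('n::finite) cps \<Rightarrow> 'n option \<Rightarrow> 'n cps poly" where
  "rees_gen f (Some j) = monom (cps_deriv j f) 1"
| "rees_gen f None = monom f 1"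

definition rees_map :: "('n::finite) cps \<Rightarrow> 'n xis_poly \<Rightarrow> 'n cps poly" where
  "rees_map f P =
     (\<Sum>a\<in>Poly_Mapping.keys P. smult (Poly_Mapping.lookup P a)
        (\<Prod>v\<in>UNIV. rees_gen f v ^ Poly_Mapping.lookup a v))"

definition ker_rees :: "('n::finite) cps \<Rightarrow> 'n xis_poly set" where
  "ker_rees f = a_kernel xis_ring (rees_algebra (jacobian_ideal f)) (rees_map f)"

definition homogeneous :: "nat \<Rightarrow> ('n::finite) xis_poly \<Rightarrow> bool" where
  "homogeneous d P \<longleftrightarrow> (\<forall>a\<in>Poly_Mapping.keys P. mdeg a = d)"

definition ker1_rees :: "('n::finite) cps \<Rightarrow> 'n xis_poly set" where
  "ker1_rees f = Idl\<^bsub>xis_ring\<^esub> {P \<in> ker_rees f. homogeneous 1 P}"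

definition linear_Jacobian_type :: "('n::finite) cps \<Rightarrow> bool" where
  "linear_Jacobian_type f \<longleftrightarrow> ker_rees f = ker1_rees f"

text \<open>\<^const>\<open>rees_map\<close> is the \<open>\<O>\<close>-algebra homomorphism into the Rees algebra with the
  prescribed values on the variables.\<close>

lemma rees_map_superset:
  assumes "finite A" "Poly_Mapping.keys P \<subseteq> A"
  shows "rees_map f P = (\<Sum>a\<in>A. smult (Poly_Mapping.lookup P a)
        (\<Prod>v\<in>UNIV. rees_gen f v ^ Poly_Mapping.lookup a v))"
  unfolding rees_map_def using assms
  by (intro sum.mono_neutral_left) (auto simp: in_keys_iff)

lemma rees_map_single:
  "rees_map f (Poly_Mapping.single a c) = smult c (\<Prod>v\<in>UNIV. rees_gen f v ^ Poly_Mapping.lookup a v)"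
  by (subst rees_map_superset[of "{a}"]) auto

lemma rees_map_add: "rees_map f (P + Q) = rees_map f P + rees_map f Q"
proof -
  let ?A = "Poly_Mapping.keys P \<union> Poly_Mapping.keys Q"
  have "Poly_Mapping.keys (P + Q) \<subseteq> ?A"
    by (rule keys_add)
  thus ?thesis
    by (simp add: rees_map_superset[of ?A] lookup_add smult_add_left sum.distrib)
qed

lemma rees_map_sum: "rees_map f (sum g A) = (\<Sum>x\<in>A. rees_map f (g x))"
  by (induction A rule: infinite_finite_induct) (auto simp: rees_map_add, auto simp: rees_map_def)

lemma xis_poly_eq_sum:
  "(P :: ('n::finite) xis_poly) = (\<Sum>a\<in>Poly_Mapping.keys P. Poly_Mapping.single a (Poly_Mapping.lookup P a))"
proof (rule poly_mapping_eqI)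
  fix k
  show "Poly_Mapping.lookup P k =
    Poly_Mapping.lookup (\<Sum>a\<in>Poly_Mapping.keys P. Poly_Mapping.single a (Poly_Mapping.lookup P a)) k"
    by (auto simp: lookup_sum lookup_single when_def in_keys_iff)
qed

lemma rees_map_mult: "rees_map f (P * Q) = rees_map f P * rees_map f Q"
proof -
  have single: "rees_map f (Poly_Mapping.single a c * Poly_Mapping.single b d)
      = rees_map f (Poly_Mapping.single a c) * rees_map f (Poly_Mapping.single b d)" for a b c d
    by (simp add: mult_single rees_map_single lookup_add power_add prod.distrib mult.commute)
  have "rees_map f (P * Q) = rees_map f
      ((\<Sum>a\<in>Poly_Mapping.keys P. Poly_Mapping.single a (Poly_Mapping.lookup P a)) *
       (\<Sum>b\<in>Poly_Mapping.keys Q. Poly_Mapping.single b (Poly_Mapping.lookup Q b)))"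
    by (simp flip: xis_poly_eq_sum)
  also have "\<dots> = rees_map f (\<Sum>a\<in>Poly_Mapping.keys P. Poly_Mapping.single a (Poly_Mapping.lookup P a)) *
       rees_map f (\<Sum>b\<in>Poly_Mapping.keys Q. Poly_Mapping.single b (Poly_Mapping.lookup Q b))"
    by (simp add: sum_product rees_map_sum single)
  finally show ?thesis
    by (simp flip: xis_poly_eq_sum)
qed

lemma rees_map_PConst: "rees_map f (PConst a) = [:a:]"
  by (simp add: PConst_def rees_map_single)

lemma rees_map_PVar: "rees_map f (PVar v) = rees_gen f v"
proof -
  have "(\<Prod>w\<in>UNIV. rees_gen f w ^ Poly_Mapping.lookup (Poly_Mapping.single v 1) w)
      = (\<Prod>w\<in>UNIV. if w = v then rees_gen f w else 1)"
    by (intro prod.cong) (auto simp: lookup_single when_def)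
  thus ?thesis
    by (simp add: PVar_def rees_map_single)
qed

lemma ideal_ideal_power:
  assumes "ideal I R"
  shows "ideal (ideal_power R I k) R"
proof -
  interpret ideal I R by fact
  show ?thesis
    by (induction k) (auto intro: oneideal ideal_prod_is_ideal assms)
qed

lemma ideal_power_add:
  assumes "cring R" "ideal I R" "x \<in> ideal_power R I k" "y \<in> ideal_power R I l"
  shows "x \<otimes>\<^bsub>R\<^esub> y \<in> ideal_power R I (k + l)"
proof -
  interpret cring R by fact
  note I = ideal_ideal_power[OF assms(2)]
  show ?thesis using assms(3)
  proof (induction k arbitrary: x)
    case 0
    thus ?case using ideal.I_l_closed[OF I assms(4)] by auto
  next
    case (Suc k)
    have c: "y \<in> carrier R" "I \<subseteq> carrier R" "ideal_power R I k \<subseteq> carrier R"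
      using assms ideal.Icarr[OF I] ideal.Icarr[OF assms(2)] by auto
    have "ideal_prod R I (ideal_power R I k) \<subseteq> carrier R"
      by (intro ideal_prod_in_carrier assms I)
    note cc = subsetD[OF this]
    from Suc.prems have "x \<in> ideal_prod R I (ideal_power R I k)" by simp
    hence "x \<otimes>\<^bsub>R\<^esub> y \<in> ideal_prod R I (ideal_power R I (k + l))"
    proof induction
      case (prod i j)
      thus ?case using c Suc.IH[of j] ideal_prod.prod[of i I "j \<otimes>\<^bsub>R\<^esub> y"]
        by (auto simp: m_assoc subset_iff)
    next
      case (sum u v)
      thus ?case using c cc by (auto simp: l_distr intro: ideal_prod.sum)
    qed
    thus ?case by simp
  qed
qed

context
  fixes J :: "('a::comm_ring_1) set"
  assumes J: "ideal J ring_of_type_algebra"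
begin

private abbreviation (input) RA :: "'a ring" where "RA \<equiv> ring_of_type_algebra"

private lemma RA_simps:
  "carrier RA = UNIV" "x \<otimes>\<^bsub>RA\<^esub> y = x * y" "x \<oplus>\<^bsub>RA\<^esub> y = x + y" "\<zero>\<^bsub>RA\<^esub> = 0" "\<one>\<^bsub>RA\<^esub> = 1"
  by (auto simp: ring_of_type_algebra_def)

lemma ideal_power_plus:
  "x \<in> ideal_power RA J k \<Longrightarrow> y \<in> ideal_power RA J k \<Longrightarrow> x + y \<in> ideal_power RA J k"
  using additive_subgroup.a_closed[OF ideal.axioms(1)[OF ideal_ideal_power[OF J]]]
  by (simp add: RA_simps)

lemma ideal_power_zero: "0 \<in> ideal_power RA J k"
  using additive_subgroup.zero_closed[OF ideal.axioms(1)[OF ideal_ideal_power[OF J, of k]]]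
  by (simp add: RA_simps)

lemma ideal_power_sum:
  "(\<And>i. i \<in> A \<Longrightarrow> h i \<in> ideal_power RA J k) \<Longrightarrow> sum h A \<in> ideal_power RA J k"
  by (induction A rule: infinite_finite_induct) (auto intro: ideal_power_plus ideal_power_zero)

lemma rees_plus:
  "p \<in> carrier (rees_algebra J) \<Longrightarrow> q \<in> carrier (rees_algebra J) \<Longrightarrow> p + q \<in> carrier (rees_algebra J)"
  by (auto simp: rees_algebra_def ideal_power_plus)

lemma rees_zero: "0 \<in> carrier (rees_algebra J)"
  by (auto simp: rees_algebra_def ideal_power_zero)

lemma rees_const: "[:c:] \<in> carrier (rees_algebra J)"
proof -
  have "coeff [:c:] i \<in> ideal_power RA J i" for i
    using ideal_power_zero[of i] by (cases i) (simp_all add: RA_simps)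
  thus ?thesis by (simp add: rees_algebra_def)
qed

lemma rees_times:
  assumes "p \<in> carrier (rees_algebra J)" "q \<in> carrier (rees_algebra J)"
  shows "p * q \<in> carrier (rees_algebra J)"
proof -
  have "coeff (p * q) k \<in> ideal_power RA J k" for k
    unfolding coeff_mult
  proof (rule ideal_power_sum)
    fix i assume "i \<in> {..k}"
    thus "coeff p i * coeff q (k - i) \<in> ideal_power RA J k"
      using ideal_power_add[OF cring_from_type_algebra J, of "coeff p i" i "coeff q (k - i)" "k - i"] assms
      by (simp add: rees_algebra_def RA_simps)
  qed
  thus ?thesis by (simp add: rees_algebra_def)
qed

lemma rees_monom:
  assumes "x \<in> J"
  shows "monom x 1 \<in> carrier (rees_algebra J)"
proof -
  have "x \<otimes>\<^bsub>RA\<^esub> 1 \<in> ideal_power RA J 1"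
    using ideal_prod.prod[of x J 1 UNIV RA] assms by (simp add: RA_simps)
  thus ?thesis
    by (auto simp: rees_algebra_def RA_simps ideal_power_zero)
qed

lemma rees_sum:
  "(\<And>i. i \<in> A \<Longrightarrow> h i \<in> carrier (rees_algebra J)) \<Longrightarrow> sum h A \<in> carrier (rees_algebra J)"
  by (induction A rule: infinite_finite_induct) (auto intro: rees_plus rees_zero)

lemma rees_prod_power:
  assumes "\<And>v. v \<in> A \<Longrightarrow> g v \<in> carrier (rees_algebra J)"
  shows "(\<Prod>v\<in>A. g v ^ e v) \<in> carrier (rees_algebra J)"
proof -
  have pow: "p ^ k \<in> carrier (rees_algebra J)" if "p \<in> carrier (rees_algebra J)" for p k
    using that rees_const[of 1] by (induction k) (auto intro: rees_times simp: one_pCons)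
  show ?thesis using assms
    using rees_const[of 1]
    by (induction A rule: infinite_finite_induct) (auto intro!: rees_times pow simp: one_pCons)
qed

end

lemma ideal_jacobian_ideal: "ideal (jacobian_ideal f) ring_of_type_algebra"
  unfolding jacobian_ideal_def
  by (intro ring.genideal_ideal ring_from_type_algebra) (simp add: ring_of_type_algebra_def)

lemma rees_map_ring_hom:
  "rees_map f \<in> ring_hom xis_ring (rees_algebra (jacobian_ideal f))"
proof (rule ring_hom_memI)
  note J = ideal_jacobian_ideal[of f]
  have sub: "insert f (range (\<lambda>j. cps_deriv j f)) \<subseteq> jacobian_ideal f"
    unfolding jacobian_ideal_def
    by (intro ring.genideal_self ring_from_type_algebra) (simp add: ring_of_type_algebra_def)
  have gen: "rees_gen f v \<in> carrier (rees_algebra (jacobian_ideal f))" for v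
    using sub by (cases v) (auto intro!: rees_monom[OF J, unfolded One_nat_def])
  have term_mem: "smult c (\<Prod>v\<in>UNIV. rees_gen f v ^ e v) \<in> carrier (rees_algebra (jacobian_ideal f))"
    for c and e :: "'a option \<Rightarrow> nat"
    using rees_times[OF J rees_const[OF J, of c] rees_prod_power[OF J, of UNIV "rees_gen f" e]] gen
    by simp
  show "rees_map f P \<in> carrier (rees_algebra (jacobian_ideal f))" for P
    unfolding rees_map_def by (intro rees_sum[OF J] term_mem)
  have "rees_map f 1 = 1"
    by (simp add: rees_map_single flip: single_one)
  thus "rees_map f \<one>\<^bsub>xis_ring\<^esub> = \<one>\<^bsub>rees_algebra (jacobian_ideal f)\<^esub>"
    by (simp add: ring_of_type_algebra_def rees_algebra_def)
qed (simp_all add: ring_of_type_algebra_def rees_algebra_def rees_map_add rees_map_mult)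

end

theory Submission
  imports Defs
begin

text \<open>
  Write \<open>S\<close> for the ring \<open>\<O>[\<xi>\<^sub>1,\<dots>,\<xi>\<^sub>n,s]\<close>, \<open>K\<close> for the kernel of \<open>\<phi>\<close> and \<open>K\<^sub>1\<close> for the ideal generated by its
  linear part. Two observations reduce the theorem to a comparison of heights.

  \<^item> \<open>K\<close> is an associated prime of \<open>K\<^sub>1\<close>. It is prime because the Rees algebra lies in the domain
    \<open>\<O>[t]\<close>. Modulo \<open>K\<^sub>1\<close> one has \<open>f \<xi>\<^sub>j = \<partial>\<^sub>j(f) s\<close>, so multiplying a polynomial \<open>P\<close> by a high power of
    \<open>f\<close> turns it into a combination of the powers \<open>s\<^sup>d\<close> whose coefficients are, up to powers of \<open>f\<close>,
    the coefficients of \<open>\<phi>(P)\<close>. If \<open>P\<close> is in \<open>K\<close>, then \<open>f\<^sup>N P\<close> is in \<open>K\<^sub>1\<close>. Since \<open>K\<close> is finitely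
    generated, one exponent \<open>N\<close> serves for all \<open>P\<close>, and \<open>K\<close> is the colon ideal \<open>(K\<^sub>1 : f\<^sup>N)\<close>.

  \<^item> If \<open>K \<noteq> K\<^sub>1\<close>, then \<open>f\<close> is a zero divisor modulo \<open>K\<^sub>1\<close>. As \<open>S\<close> is Noetherian, some associated prime
    \<open>Q\<close> of \<open>K\<^sub>1\<close> contains \<open>f\<close>. It also contains all \<open>\<sigma>(\<delta>\<^sub>i) - \<alpha>\<^sub>i s\<close>, so strong Saito-holonomicity forces its
    height to be at least \<open>n + 1\<close>. Unmixedness then gives \<open>K\<close> the same height. But \<open>K\<close> has height at most
    \<open>n\<close>, a contradiction.

  Three general facts carry this argument.

  \<^item> \<open>S\<close> is Noetherian (\<open>noetherian_cps\<close>, \<open>noetherian_poly_mapping\<close>). For \<open>\<O>\<close> this follows from Grauert's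
    division theorem (\<open>convergent_division\<close>) and Dickson's lemma; for polynomials over a Noetherian ring
    it is Hilbert's basis theorem.

  \<^item> \<open>K\<close> has height at most \<open>n\<close> (\<open>prime_height_ker_rees\<close>). Elements chosen in the successive steps of a
    chain of \<open>k\<close> inclusions of primes ending in \<open>K\<close> are, together with \<open>s\<close>, algebraically independent over
    \<open>\<O>\<close>, because no nonzero polynomial in \<open>s\<close> over \<open>\<O>\<close> lies in \<open>K\<close>. Counting monomials shows that
    \<open>n + 2\<close> polynomials in \<open>n + 1\<close> variables are algebraically dependent.

  \<^item> A derivation of \<open>\<O>\<close> is determined by its values on the coordinates
    (\<open>derivation_eq_sum_cps_deriv\<close>), which puts \<open>\<sigma>(\<delta>) - \<alpha> s\<close> into \<open>K\<^sub>1\<close> for every logarithmic \<open>\<delta>\<close>.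
\<close>

section \<open>Ideals and Noetherian rings\<close>

text \<open>An ideal of a commutative ring is a submodule of the ring, so the theory of spans supplies
  generated ideals. The next lemmas translate the record-based notions into this language.\<close>

interpretation ideals: Modules.module "(*) :: 'a::comm_ring_1 \<Rightarrow> 'a \<Rightarrow> 'a"
  by unfold_locales (simp_all add: algebra_simps)

text \<open>The module law \<open>a (b x) = (a b) x\<close> is a simplification rule of the interpretation. It undoes
  \<open>mult.assoc\<close>, and the two together do not terminate.\<close>
declare ideals.scale_scale [simp del]

lemma type_ring_simps [simp]:
  "carrier ring_of_type_algebra = UNIV" "x \<otimes>\<^bsub>ring_of_type_algebra\<^esub> y = x * y"
  "x \<oplus>\<^bsub>ring_of_type_algebra\<^esub> y = x + y" "\<zero>\<^bsub>ring_of_type_algebra\<^esub> = 0" "\<one>\<^bsub>ring_of_type_algebra\<^esub> = 1"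
  by (auto simp: ring_of_type_algebra_def)

lemma ideal_type_ring_iff:
  "ideal I (ring_of_type_algebra :: 'a::comm_ring_1 ring) \<longleftrightarrow> ideals.subspace I"
proof
  assume "ideal I (ring_of_type_algebra :: 'a ring)"
  then interpret ideal I "ring_of_type_algebra :: 'a ring" .
  show "ideals.subspace I"
    unfolding ideals.subspace_def
    using additive_subgroup.zero_closed[OF is_additive_subgroup]
      additive_subgroup.a_closed[OF is_additive_subgroup] I_l_closed
    by auto
next
  assume I: "ideals.subspace I"
  have inv: "inv\<^bsub>add_monoid (ring_of_type_algebra :: 'a ring)\<^esub> x = - x" for x
  proof -
    interpret R: ring "ring_of_type_algebra :: 'a ring" by (rule ring_from_type_algebra)
    have "\<ominus>\<^bsub>ring_of_type_algebra\<^esub> x = - x"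
      using R.minus_equality[of "- x" x] by simp
    thus ?thesis by (simp add: a_inv_def)
  qed
  show "ideal I (ring_of_type_algebra :: 'a ring)"
  proof (rule idealI[OF ring_from_type_algebra])
    show "subgroup I (add_monoid (ring_of_type_algebra :: 'a ring))"
    proof
      fix x assume "x \<in> I"
      thus "inv\<^bsub>add_monoid (ring_of_type_algebra :: 'a ring)\<^esub> x \<in> I"
        unfolding inv by (rule ideals.subspace_neg[OF I])
    qed (use I in \<open>auto simp: ideals.subspace_add ideals.subspace_0\<close>)
    fix a x assume "a \<in> I"
    thus "x \<otimes>\<^bsub>ring_of_type_algebra\<^esub> a \<in> I" "a \<otimes>\<^bsub>ring_of_type_algebra\<^esub> x \<in> I"
      using ideals.subspace_scale[OF I, of a x] by (simp_all add: mult.commute)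
  qed
qed

lemma genideal_type_ring:
  "Idl\<^bsub>ring_of_type_algebra :: 'a::comm_ring_1 ring\<^esub> B = ideals.span B"
  unfolding genideal_def ideal_type_ring_iff ideals.span_def hull_def by (simp add: conj_commute)

lemma primeideal_type_ring_iff:
  "primeideal P (ring_of_type_algebra :: 'a::comm_ring_1 ring) \<longleftrightarrow>
     ideals.subspace P \<and> 1 \<notin> P \<and> (\<forall>x y. x * y \<in> P \<longrightarrow> x \<in> P \<or> y \<in> P)" (is "_ \<longleftrightarrow> ?R")
proof
  assume P: "primeideal P (ring_of_type_algebra :: 'a ring)"
  then have s: "ideals.subspace P"
    using primeideal.axioms(1) ideal_type_ring_iff by blast
  have "1 \<notin> P"
  proof
    assume "1 \<in> P"
    hence "x \<in> P" for x using ideals.subspace_scale[OF s, of 1 x] by simp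
    thus False using primeideal.I_notcarr[OF P] by auto
  qed
  with s show ?R using primeideal.I_prime[OF P] by auto
next
  assume ?R
  thus "primeideal P (ring_of_type_algebra :: 'a ring)"
    by (intro primeidealI cring_from_type_algebra) (auto simp: ideal_type_ring_iff)
qed

definition noetherian :: "'a::comm_ring_1 itself \<Rightarrow> bool" where
  "noetherian _ \<longleftrightarrow> (\<forall>I :: 'a set. ideals.subspace I \<longrightarrow> (\<exists>B. finite B \<and> ideals.span B = I))"

text \<open>The union of a chain of ideals in \<open>\<A>\<close> is an ideal; its finitely many generators already lie in one
  member of the chain, which is therefore the whole union. Zorn's lemma applies.\<close>

lemma noetherian_maximal:
  fixes \<A> :: "'a::comm_ring_1 set set"
  assumes "noetherian TYPE('a)" and "\<A> \<noteq> {}" and sub: "\<And>I. I \<in> \<A> \<Longrightarrow> ideals.subspace I"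
  obtains M where "M \<in> \<A>" and "\<And>N. N \<in> \<A> \<Longrightarrow> M \<subseteq> N \<Longrightarrow> N = M"
proof -
  have "\<exists>M\<in>\<A>. \<forall>U\<in>\<A>. M \<subseteq> U \<longrightarrow> U = M"
  proof (rule subset_Zorn_nonempty[OF \<open>\<A> \<noteq> {}\<close>])
    fix Ch assume C: "Ch \<noteq> {}" "subset.chain \<A> Ch"
    hence CA: "Ch \<subseteq> \<A>" and tot: "\<And>U V. U \<in> Ch \<Longrightarrow> V \<in> Ch \<Longrightarrow> U \<subseteq> V \<or> V \<subseteq> U"
      by (auto simp: subset_chain_def)
    have "ideals.subspace (\<Union>Ch)"
      unfolding ideals.subspace_def
    proof (intro conjI ballI allI)
      show "0 \<in> \<Union>Ch" using C(1) CA sub ideals.subspace_0 by blast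
    next
      fix x y assume "x \<in> \<Union>Ch" "y \<in> \<Union>Ch"
      then obtain U V where UV: "U \<in> Ch" "V \<in> Ch" "x \<in> U" "y \<in> V" by blast
      with tot obtain W where "W \<in> Ch" "x \<in> W" "y \<in> W" by blast
      thus "x + y \<in> \<Union>Ch"
        using CA sub[of W] ideals.subspace_add by blast
    next
      fix c x assume "x \<in> \<Union>Ch"
      thus "c * x \<in> \<Union>Ch" using CA sub ideals.subspace_scale by (meson UnionE UnionI subsetD)
    qed
    then obtain B where B: "finite B" "ideals.span B = \<Union>Ch"
      using assms(1) unfolding noetherian_def by blast
    have "B \<subseteq> \<Union>Ch" using B(2) ideals.span_superset by blast
    then obtain U where U: "U \<in> Ch" "B \<subseteq> U"
      using finite_subset_Union_chain[OF B(1) _ C] by blast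
    have "\<Union>Ch \<subseteq> U"
      unfolding B(2)[symmetric] using U CA sub by (intro ideals.span_minimal) auto
    hence "\<Union>Ch = U" using U by blast
    thus "\<Union>Ch \<in> \<A>" using U CA by auto
  qed
  thus thesis using that by blast
qed

lemma noetherian_sequence:
  fixes c :: "nat \<Rightarrow> 'a::comm_ring_1"
  assumes "noetherian TYPE('a)"
  obtains k where "c k \<in> ideals.span (c ` {..<k})"
proof -
  let ?S = "\<lambda>k. ideals.span (c ` {..<k})"
  have "range ?S \<noteq> {}" and "\<And>I. I \<in> range ?S \<Longrightarrow> ideals.subspace I" by auto
  from noetherian_maximal[OF assms this] obtain M
    where M: "M \<in> range ?S" and max: "\<And>N. N \<in> range ?S \<Longrightarrow> M \<subseteq> N \<Longrightarrow> N = M"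
    by metis
  from M obtain k where k: "M = ?S k" by blast
  have "ideals.span (c ` {..<Suc k}) = ideals.span (c ` {..<k})"
    unfolding k[symmetric] by (rule max) (auto simp: k intro!: ideals.span_mono)
  moreover have "c k \<in> ideals.span (c ` {..<Suc k})" by (intro ideals.span_base) auto
  ultimately show thesis using that by blast
qed

text \<open>A maximal element \<open>P = (I : a)\<close> among the proper colon ideals \<open>(I : a)\<close> that contain \<open>x\<close> is prime: if
  \<open>u v \<in> P\<close> and \<open>u \<notin> P\<close>, then \<open>(I : u a)\<close> is another such ideal above \<open>P\<close>, hence equal to \<open>P\<close>, and it
  contains \<open>v\<close>.\<close>

lemma ex_associated_prime:
  fixes I :: "'a::comm_ring_1 set"
  assumes noeth: "noetherian TYPE('a)" and I: "ideals.subspace I"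
    and "g \<notin> I" "x * g \<in> I"
  obtains P where "P \<in> associated_primes ring_of_type_algebra I" "I \<subseteq> P" "x \<in> P"
proof -
  define \<A> where "\<A> = {{r. r * a \<in> I} | a. a \<notin> I \<and> x * a \<in> I}"
  have "{r. r * g \<in> I} \<in> \<A>" unfolding \<A>_def using assms(3,4) by blast
  hence ne: "\<A> \<noteq> {}" by blast
  have colon: "ideals.subspace {r. r * a \<in> I}" for a
  proof (rule ideals.subspaceI)
    show "0 \<in> {r. r * a \<in> I}" using ideals.subspace_0[OF I] by simp
    show "r + t \<in> {r. r * a \<in> I}" if "r \<in> {r. r * a \<in> I}" "t \<in> {r. r * a \<in> I}" for r t
      using that ideals.subspace_add[OF I, of "r * a" "t * a"] by (simp add: distrib_right)
    show "c * r \<in> {r. r * a \<in> I}" if "r \<in> {r. r * a \<in> I}" for c r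
      using that ideals.subspace_scale[OF I, of "r * a" c] by (simp add: mult.assoc)
  qed
  have "\<And>J. J \<in> \<A> \<Longrightarrow> ideals.subspace J" unfolding \<A>_def using colon by blast
  from noetherian_maximal[OF noeth ne this] obtain P
    where P: "P \<in> \<A>" and max: "\<And>N. N \<in> \<A> \<Longrightarrow> P \<subseteq> N \<Longrightarrow> N = P"
    by blast
  from P obtain a where a: "P = {r. r * a \<in> I}" "a \<notin> I" "x * a \<in> I"
    unfolding \<A>_def by blast
  have "v \<in> P" if uv: "u * v \<in> P" "u \<notin> P" for u v
  proof -
    have "{r. r * (u * a) \<in> I} = P"
    proof (rule max)
      show "{r. r * (u * a) \<in> I} \<in> \<A>"
      proof -
        have "u * a \<notin> I" using uv(2) a(1) by simp
        moreover have "x * (u * a) \<in> I"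
          using ideals.subspace_scale[OF I a(3), of u] by (simp add: mult.left_commute)
        ultimately show ?thesis unfolding \<A>_def by blast
      qed
      show "P \<subseteq> {r. r * (u * a) \<in> I}"
        unfolding a(1)
      proof clarsimp
        fix t assume "t * a \<in> I"
        from ideals.subspace_scale[OF I this, of u] show "t * (u * a) \<in> I"
          by (simp only: mult.left_commute)
      qed
    qed
    moreover have "v * (u * a) \<in> I" using uv(1) a(1) by (simp add: mult_ac)
    ultimately show ?thesis by blast
  qed
  moreover have "1 \<notin> P" using a by simp
  ultimately have "primeideal P (ring_of_type_algebra :: 'a ring)"
    unfolding primeideal_type_ring_iff using colon a(1) by blast
  hence "P \<in> associated_primes ring_of_type_algebra I"
    using a(1) unfolding associated_primes_def by auto
  moreover have "I \<subseteq> P" unfolding a(1) using ideals.subspace_scale[OF I, of _ a] by (simp add: subset_iff mult.commute)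
  ultimately show thesis using that a(1,3) by blast
qed

section \<open>Weights of exponents and Dickson's lemma\<close>

lemma ex_inj_prime: "\<exists>p :: 'v::finite \<Rightarrow> nat. inj p \<and> (\<forall>v. Factorial_Ring.prime (p v))"
proof -
  obtain A :: "nat set" where A: "finite A" "card A = card (UNIV :: 'v set)" "A \<subseteq> {p. Factorial_Ring.prime p}"
    using infinite_arbitrarily_large[OF primes_infinite] by blast
  obtain p where "bij_betw p (UNIV :: 'v set) A"
    using finite_same_card_bij[of "UNIV :: 'v set" A] A by auto
  thus ?thesis using A(3) by (intro exI[of _ p]) (auto simp: bij_betw_def)
qed

definition var_prime :: "'v::finite \<Rightarrow> nat" where
  "var_prime = (SOME p. inj p \<and> (\<forall>v. Factorial_Ring.prime (p v)))"

lemma inj_var_prime: "inj var_prime" and prime_var_prime: "Factorial_Ring.prime (var_prime v)"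
  using someI_ex[OF ex_inj_prime] unfolding var_prime_def by blast+

text \<open>Attaching distinct primes to the variables makes the weight of exponents multiplicative and, by
  unique factorization, injective. It thus replaces a monomial order: its values are natural numbers,
  and only finitely many exponents lie below a given bound.\<close>

definition weight :: "('v::finite) mexp \<Rightarrow> nat" where
  "weight a = (\<Prod>v\<in>UNIV. var_prime v ^ Poly_Mapping.lookup a v)"

lemma weight_add: "weight (a + b) = weight a * weight b"
  by (simp add: weight_def lookup_add power_add prod.distrib)

lemma weight_pos: "weight a > 0"
  unfolding weight_def by (intro prod_pos) (auto simp: prime_gt_0_nat prime_var_prime)

lemma inj_weight: "inj (weight :: ('v::finite) mexp \<Rightarrow> nat)"
proof (rule injI, rule poly_mapping_eqI)
  fix a b :: "'v mexp" and v
  assume eq: "weight a = weight b"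
  have "multiplicity (var_prime v) (weight c) = Poly_Mapping.lookup c v" for c :: "'v mexp"
  proof -
    let ?e = "\<lambda>p. Poly_Mapping.lookup c (inv_into UNIV var_prime p)"
    have inverse: "inv_into UNIV var_prime (var_prime w) = w" for w :: 'v
      by (rule inv_f_f[OF inj_var_prime])
    have "weight c = (\<Prod>p\<in>range (var_prime :: 'v \<Rightarrow> nat). p ^ ?e p)"
      unfolding weight_def
      by (subst prod.reindex) (simp_all add: inj_var_prime inverse)
    moreover have "Factorial_Ring.prime q" if "q \<in> range (var_prime :: 'v \<Rightarrow> nat)" for q
      using that prime_var_prime by auto
    ultimately show ?thesis
      using multiplicity_prod_prime_powers[of "range (var_prime :: 'v \<Rightarrow> nat)" "var_prime v" ?e]
      by (simp add: prime_var_prime inverse)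
  qed
  with eq show "Poly_Mapping.lookup a v = Poly_Mapping.lookup b v" by metis
qed

lemma weight_eq_iff [simp]: "weight a = weight b \<longleftrightarrow> a = b"
  using inj_weight by (auto dest: injD)

lemma finite_weight_le: "finite {a. weight a \<le> N}"
  using finite_vimageI[OF _ inj_weight, of "{..N}"] by (simp add: vimage_def)

lemma nat_mono_subseq:
  fixes s :: "nat \<Rightarrow> nat"
  obtains f :: "nat \<Rightarrow> nat" where "strict_mono f" "mono (s \<circ> f)"
proof -
  obtain f :: "nat \<Rightarrow> nat" where f: "strict_mono f" "monoseq (\<lambda>n. s (f n))" using seq_monosub by blast
  from f(2) consider "mono (s \<circ> f)" | "decseq (s \<circ> f)"
    by (auto simp: monoseq_iff comp_def)
  thus thesis
  proof cases
    case 2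
    obtain N where N: "\<And>n. s (f N) \<le> s (f n)"
      using ex_has_least_nat[of "\<lambda>_. True" 0 "\<lambda>n. s (f n)"] by blast
    have "s (f (N + n)) = s (f N)" for n
      using 2 N[of "N + n"] by (auto simp: decseq_def intro: antisym)
    hence "mono (s \<circ> (\<lambda>n. f (N + n)))" by (simp add: mono_def)
    moreover have "strict_mono (\<lambda>n. f (N + n))" using f(1) by (simp add: strict_mono_def)
    ultimately show thesis by (intro that[of "\<lambda>n. f (N + n)"])
  qed (use f(1) that[of f] in blast)
qed

text \<open>Passing to a subsequence once for every variable makes each coordinate of the exponents
  nondecreasing.\<close>

lemma Dickson:
  fixes a :: "nat \<Rightarrow> ('v::finite) mexp"
  obtains r :: "nat \<Rightarrow> nat" where "strict_mono r" "\<And>i j. i \<le> j \<Longrightarrow> \<exists>d. a (r j) = d + a (r i)"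
proof -
  have "\<exists>r :: nat \<Rightarrow> nat. strict_mono r \<and> (\<forall>v\<in>V. mono (\<lambda>i. Poly_Mapping.lookup (a (r i)) v))" if "finite V" for V
    using that
  proof induction
    case empty
    show ?case by (intro exI[of _ "\<lambda>i. i"]) (simp add: strict_mono_def)
  next
    case (insert w V)
    then obtain r :: "nat \<Rightarrow> nat" where r: "strict_mono r" "\<forall>v\<in>V. mono (\<lambda>i. Poly_Mapping.lookup (a (r i)) v)"
      by blast
    obtain f :: "nat \<Rightarrow> nat"
      where f: "strict_mono f" "mono ((\<lambda>i. Poly_Mapping.lookup (a (r i)) w) \<circ> f)"
      by (rule nat_mono_subseq)
    show ?case
    proof (intro exI conjI ballI)
      show "strict_mono (r \<circ> f)" using r(1) f(1) by (rule strict_mono_o)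
      show "mono (\<lambda>i. Poly_Mapping.lookup (a ((r \<circ> f) i)) v)" if "v \<in> insert w V" for v
        using that r(2) f strict_mono_mono[OF f(1)] by (auto simp: mono_def)
    qed
  qed
  from this[of UNIV] obtain r :: "nat \<Rightarrow> nat" where r: "strict_mono r"
    "\<And>v. mono (\<lambda>i. Poly_Mapping.lookup (a (r i)) v)" by auto
  show thesis
  proof (rule that[OF r(1)])
    fix i j :: nat assume "i \<le> j"
    hence "a (r j) = (a (r j) - a (r i)) + a (r i)"
      using r(2) by (intro poly_mapping_eqI) (simp add: lookup_add lookup_minus mono_def)
    thus "\<exists>d. a (r j) = d + a (r i)" by blast
  qed
qed

text \<open>Otherwise one could choose in \<open>S\<close> successively elements that lie above none of the earlier ones.\<close>

lemma Dickson_basis: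
  fixes S :: "('v::finite) mexp set"
  obtains T where "finite T" "T \<subseteq> S" "\<And>s. s \<in> S \<Longrightarrow> \<exists>t\<in>T. \<exists>d. s = d + t"
proof -
  have "\<exists>T. finite T \<and> T \<subseteq> S \<and> (\<forall>s\<in>S. \<exists>t\<in>T. \<exists>d. s = d + t)"
  proof (rule ccontr)
    assume neg: "\<not> ?thesis"
    let ?Q = "\<lambda>h k s. (\<forall>j<k::nat. h j \<in> S) \<longrightarrow> s \<in> S \<and> (\<forall>j<k. \<forall>d. s \<noteq> d + h j)"
    have "\<exists>h. \<forall>k. ?Q h k (h k)"
    proof (rule dependent_wellorder_choice)
      fix r :: "'v mexp" and f g :: "nat \<Rightarrow> 'v mexp" and k
      assume "\<And>j. j < k \<Longrightarrow> f j = g j"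
      thus "?Q f k r = ?Q g k r" by simp
    next
      fix k and h :: "nat \<Rightarrow> 'v mexp"
      show "\<exists>s. ?Q h k s"
      proof (cases "\<forall>j<k. h j \<in> S")
        case True
        have "\<not> (\<forall>s\<in>S. \<exists>t\<in>h ` {..<k}. \<exists>d. s = d + t)"
        proof
          assume "\<forall>s\<in>S. \<exists>t\<in>h ` {..<k}. \<exists>d. s = d + t"
          moreover have "finite (h ` {..<k})" "h ` {..<k} \<subseteq> S" using True by auto
          ultimately show False using neg by blast
        qed
        then obtain s where "s \<in> S" "\<And>t d. t \<in> h ` {..<k} \<Longrightarrow> s \<noteq> d + t" by blast
        thus ?thesis by (intro exI[of _ s]) simp
      qed blast
    qed
    then obtain h where h: "\<And>k. ?Q h k (h k)" by blast
    have hS: "h k \<in> S" for k by (induction k rule: less_induct) (use h in blast)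
    obtain r :: "nat \<Rightarrow> nat" where "strict_mono r" "\<And>i j. i \<le> j \<Longrightarrow> \<exists>d. h (r j) = d + h (r i)"
      using Dickson[of h] by metis
    hence "r 0 < r 1" and above: "\<exists>d. h (r 1) = d + h (r 0)" by (simp_all add: strict_mono_less)
    moreover have "\<forall>j<r 1. \<forall>d. h (r 1) \<noteq> d + h j" using h[of "r 1"] hS by simp
    ultimately show False by metis
  qed
  thus thesis using that by blast
qed

section \<open>Hilbert's basis theorem\<close>

lemma span_image_sum:
  fixes c :: "'i \<Rightarrow> 'a::comm_ring_1"
  assumes "x \<in> ideals.span (c ` A)" "finite A"
  obtains b where "x = (\<Sum>i\<in>A. b i * c i)"
proof -
  have "\<exists>b. x = (\<Sum>i\<in>A. b i * c i)" using assms(1)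
  proof (induction rule: ideals.span_induct_alt)
    case base
    show ?case by (rule exI[of _ "\<lambda>_. 0"]) simp
  next
    case (step t y z)
    then obtain j b where jb: "j \<in> A" "y = c j" "z = (\<Sum>i\<in>A. b i * c i)" by blast
    have "(\<Sum>i\<in>A. ((if i = j then t else 0) + b i) * c i) =
      (\<Sum>i\<in>A. if i = j then t * c i else 0) + (\<Sum>i\<in>A. b i * c i)"
      unfolding sum.distrib[symmetric] by (intro sum.cong) (auto simp: algebra_simps)
    also have "\<dots> = t * y + z" using jb assms(2) by simp
    finally show ?case by metis
  qed
  thus thesis using that by blast
qed

lemma lookup_single_times:
  fixes p :: "('v::finite) mexp \<Rightarrow>\<^sub>0 'a::comm_ring_1"
  shows "Poly_Mapping.lookup (Poly_Mapping.single d b * p) (d + x) = b * Poly_Mapping.lookup p x"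
proof -
  have p: "p = (\<Sum>a\<in>Poly_Mapping.keys p. Poly_Mapping.single a (Poly_Mapping.lookup p a))"
    by (rule poly_mapping_eqI) (auto simp: lookup_sum lookup_single when_def in_keys_iff)
  have "Poly_Mapping.lookup (Poly_Mapping.single d b * p) (d + x) =
      Poly_Mapping.lookup (\<Sum>a\<in>Poly_Mapping.keys p.
        Poly_Mapping.single (d + a) (b * Poly_Mapping.lookup p a)) (d + x)"
    by (subst p) (simp add: sum_distrib_left mult_single)
  also have "\<dots> = b * Poly_Mapping.lookup p x"
    by (auto simp: lookup_sum lookup_single when_def in_keys_iff)
  finally show ?thesis .
qed

definition top_exp :: "(('v::finite) mexp \<Rightarrow>\<^sub>0 'a::zero) \<Rightarrow> 'v mexp" where
  "top_exp p = (SOME a. a \<in> Poly_Mapping.keys p \<and> (\<forall>b\<in>Poly_Mapping.keys p. weight b \<le> weight a))"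

lemma top_exp:
  assumes "p \<noteq> 0"
  shows top_exp_in: "top_exp p \<in> Poly_Mapping.keys p"
    and weight_le_top_exp: "\<And>b. b \<in> Poly_Mapping.keys p \<Longrightarrow> weight b \<le> weight (top_exp p)"
proof -
  have ne: "Poly_Mapping.keys p \<noteq> {}"
    using assms by (metis in_keys_iff empty_iff lookup_zero poly_mapping_eqI)
  have "Max (weight ` Poly_Mapping.keys p) \<in> weight ` Poly_Mapping.keys p"
    using ne by (intro Max_in) auto
  then obtain a where a: "a \<in> Poly_Mapping.keys p" "weight a = Max (weight ` Poly_Mapping.keys p)"
    by auto
  have "\<exists>a. a \<in> Poly_Mapping.keys p \<and> (\<forall>b\<in>Poly_Mapping.keys p. weight b \<le> weight a)"
    using a by (intro exI[of _ a]) auto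
  from someI_ex[OF this] show "top_exp p \<in> Poly_Mapping.keys p"
    "\<And>b. b \<in> Poly_Mapping.keys p \<Longrightarrow> weight b \<le> weight (top_exp p)"
    unfolding top_exp_def by blast+
qed

text \<open>Hilbert's argument for all variables at once. If \<open>I\<close> is not finitely generated, choose \<open>h\<^sub>0, h\<^sub>1, \<dots>\<close>
  in \<open>I\<close>, each outside the ideal of its predecessors and with leading exponent of least possible weight.
  Along a subsequence the leading exponents increase componentwise, and some leading coefficient is a
  combination of the earlier ones. Subtracting the corresponding combination of earlier \<open>h\<^sub>i\<close> cancels the
  leading term and contradicts minimality.\<close>

theorem noetherian_poly_mapping:
  assumes noeth: "noetherian TYPE('a::comm_ring_1)"
  shows "noetherian TYPE(('v::finite) mexp \<Rightarrow>\<^sub>0 'a)"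
  unfolding noetherian_def
proof (intro allI impI, rule ccontr)
  fix I :: "('v mexp \<Rightarrow>\<^sub>0 'a) set"
  assume I: "ideals.subspace I" and nfg: "\<nexists>B. finite B \<and> ideals.span B = I"
  \<comment> \<open>A choice must exist for every prefix \<open>h\<close>; for those not contained in \<open>I\<close> nothing is demanded.\<close>
  let ?Q = "\<lambda>h k g. (\<forall>j<k. h j \<in> I) \<longrightarrow> g \<in> I \<and> g \<notin> ideals.span (h ` {..<k::nat}) \<and>
    (\<forall>g'\<in>I. g' \<notin> ideals.span (h ` {..<k}) \<longrightarrow> weight (top_exp g) \<le> weight (top_exp g'))"
  have "\<exists>h. \<forall>k. ?Q h k (h k)"
  proof (rule dependent_wellorder_choice)
    fix r :: "'v mexp \<Rightarrow>\<^sub>0 'a" and f g :: "nat \<Rightarrow> 'v mexp \<Rightarrow>\<^sub>0 'a" and k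
    assume "\<And>j. j < k \<Longrightarrow> f j = g j"
    moreover from this have "f ` {..<k} = g ` {..<k}" by (auto simp: image_iff)
    ultimately show "?Q f k r = ?Q g k r" by simp
  next
    fix k and h :: "nat \<Rightarrow> 'v mexp \<Rightarrow>\<^sub>0 'a"
    show "\<exists>g. ?Q h k g"
    proof (cases "\<forall>j<k. h j \<in> I")
      case True
      hence "ideals.span (h ` {..<k}) \<subseteq> I" using I by (intro ideals.span_minimal) auto
      moreover have "ideals.span (h ` {..<k}) \<noteq> I" using nfg by blast
      ultimately obtain g where g: "g \<in> I \<and> g \<notin> ideals.span (h ` {..<k})" by blast
      from ex_has_least_nat[of "\<lambda>g. g \<in> I \<and> g \<notin> ideals.span (h ` {..<k})", OF g,
          of "\<lambda>g. weight (top_exp g)"]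
      show ?thesis by blast
    qed auto
  qed
  then obtain h where h: "\<And>k. ?Q h k (h k)" by blast
  have hI: "h k \<in> I" for k
    by (induction k rule: less_induct) (use h in blast)
  have notin: "h k \<notin> ideals.span (h ` {..<k})"
    and min: "\<And>g. g \<in> I \<Longrightarrow> g \<notin> ideals.span (h ` {..<k}) \<Longrightarrow>
      weight (top_exp (h k)) \<le> weight (top_exp g)" for k
    using h[of k] hI by blast+
  have nz: "h k \<noteq> 0" for k using notin[of k] ideals.span_zero by metis
  obtain r :: "nat \<Rightarrow> nat" where r: "strict_mono r"
    and "\<And>i j. i \<le> j \<Longrightarrow> \<exists>d. top_exp (h (r j)) = d + top_exp (h (r i))"
    using Dickson[of "\<lambda>k. top_exp (h k)"] by metis
  then obtain d where d: "\<And>i j. i \<le> j \<Longrightarrow> top_exp (h (r j)) = d i j + top_exp (h (r i))"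
    by metis
  define c :: "nat \<Rightarrow> 'a" where "c i = Poly_Mapping.lookup (h (r i)) (top_exp (h (r i)))" for i
  obtain k where "c k \<in> ideals.span (c ` {..<k})" using noetherian_sequence[OF noeth, of c] .
  then obtain b where b: "c k = (\<Sum>i<k. b i * c i)"
    using span_image_sum[of "c k" c "{..<k}"] by auto
  define S where "S = (\<Sum>i<k. Poly_Mapping.single (d i k) (b i) * h (r i))"
  define g where "g = h (r k) - S"
  let ?T = "top_exp (h (r k))"
  have "S \<in> ideals.span (h ` {..<r k})"
    unfolding S_def using r by (intro ideals.span_sum ideals.span_scale ideals.span_base)
      (auto simp: strict_mono_less)
  hence gn: "g \<notin> ideals.span (h ` {..<r k})"
    using notin[of "r k"] ideals.span_add[of g _ S] by (auto simp: g_def)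
  have "g \<in> I"
    unfolding g_def S_def
    by (intro ideals.subspace_diff[OF I] ideals.subspace_sum[OF I] ideals.subspace_scale[OF I] hI)
  hence ge: "weight ?T \<le> weight (top_exp g)" by (rule min[OF _ gn])
  have "g \<noteq> 0" using gn ideals.span_zero by metis
  note top = top_exp_in[OF this]
  have le: "weight a \<le> weight ?T" if a: "a \<in> Poly_Mapping.keys g" for a
  proof -
    from a consider "a \<in> Poly_Mapping.keys (h (r k))" | "a \<in> Poly_Mapping.keys S"
      by (cases "Poly_Mapping.lookup S a = 0") (auto simp: g_def in_keys_iff lookup_minus)
    thus ?thesis
    proof cases
      case 1
      thus ?thesis by (rule weight_le_top_exp[OF nz])
    next
      case 2
      then obtain i where i: "i < k"
        "a \<in> Poly_Mapping.keys (Poly_Mapping.single (d i k) (b i) * h (r i))"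
        unfolding S_def in_keys_iff lookup_sum by (meson lessThan_iff sum.neutral)
      obtain x where x: "a = d i k + x" "x \<in> Poly_Mapping.keys (h (r i))"
        using subsetD[OF keys_mult i(2)] by (auto split: if_splits)
      have "weight a \<le> weight (d i k) * weight (top_exp (h (r i)))"
        using weight_le_top_exp[OF nz x(2)] by (simp add: x weight_add)
      also have "\<dots> = weight ?T" using d[of i k] i by (simp add: weight_add)
      finally show ?thesis .
    qed
  qed
  have "Poly_Mapping.lookup S ?T = (\<Sum>i<k. b i * c i)"
    unfolding S_def lookup_sum
  proof (rule sum.cong)
    fix i assume "i \<in> {..<k}"
    hence "?T = d i k + top_exp (h (r i))" by (intro d) auto
    thus "Poly_Mapping.lookup (Poly_Mapping.single (d i k) (b i) * h (r i)) ?T = b i * c i"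
      by (simp only: lookup_single_times c_def)
  qed auto
  hence "Poly_Mapping.lookup g ?T = 0"
    using b by (simp add: g_def lookup_minus c_def)
  moreover have "top_exp g = ?T" using ge le[OF top] by (metis antisym weight_eq_iff)
  ultimately show False using top by (simp add: in_keys_iff)
qed

section \<open>Convergent power series form a Noetherian domain\<close>

lemma cps_coeff_mult:
  "cps_coeff (f * g) d = (\<Sum>(a, b)\<in>antidiag d. cps_coeff f a * cps_coeff g b)"
  by (simp add: times_cps.rep_eq)

lemma cps_coeff_add [simp]: "cps_coeff (f + g) a = cps_coeff f a + cps_coeff g a"
  and cps_coeff_0 [simp]: "cps_coeff 0 a = 0"
  by (simp_all add: plus_cps.rep_eq zero_cps.rep_eq)

lemma cps_coeff_sum: "cps_coeff (sum F A) a = (\<Sum>x\<in>A. cps_coeff (F x) a)"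
  by (induction A rule: infinite_finite_induct) auto

definition low_exp :: "('n::finite) cps \<Rightarrow> 'n mexp" where
  "low_exp g = arg_min weight (\<lambda>a. cps_coeff g a \<noteq> 0)"

lemma low_exp:
  assumes "g \<noteq> 0"
  shows coeff_low_exp: "cps_coeff g (low_exp g) \<noteq> 0"
    and weight_low_exp_le: "\<And>a. cps_coeff g a \<noteq> 0 \<Longrightarrow> weight (low_exp g) \<le> weight a"
proof -
  obtain a where "cps_coeff g a \<noteq> 0" using assms cps_eqI[of g 0] by auto
  thus "cps_coeff g (low_exp g) \<noteq> 0"
    "\<And>a. cps_coeff g a \<noteq> 0 \<Longrightarrow> weight (low_exp g) \<le> weight a"
    unfolding low_exp_def
    using arg_min_nat_lemma[of "\<lambda>a. cps_coeff g a \<noteq> 0" _ weight] by auto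
qed

text \<open>The coefficient of a product at the sum of the two exponents of least weight receives only one
  nonzero contribution, since the weight is multiplicative and injective.\<close>

instance cps :: (finite) idom
proof
  fix f g :: "'a cps"
  assume nz: "f \<noteq> 0" "g \<noteq> 0"
  let ?a = "low_exp f" and ?b = "low_exp g"
  have unique: "a = ?a \<and> b = ?b"
    if ab: "(a, b) \<in> antidiag (?a + ?b)" "cps_coeff f a \<noteq> 0" "cps_coeff g b \<noteq> 0" for a b
  proof -
    have le: "weight ?a \<le> weight a" "weight ?b \<le> weight b"
      using ab nz weight_low_exp_le by blast+
    have eq: "weight a * weight b = weight ?a * weight ?b"
      using ab(1) by (simp add: antidiag_def flip: weight_add)
    have "weight a = weight ?a"
    proof (rule ccontr)
      assume "weight a \<noteq> weight ?a"
      hence "weight ?a * weight ?b < weight a * weight b"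
        using le weight_pos[of ?b]
        by (intro mult_less_le_imp_less) (auto simp del: weight_eq_iff)
      thus False using eq by simp
    qed
    moreover from this have "weight b = weight ?b"
      using eq weight_pos[of ?a] by simp
    ultimately show ?thesis by simp
  qed
  have "cps_coeff (f * g) (?a + ?b) =
      (\<Sum>(a, b)\<in>{(?a, ?b)}. cps_coeff f a * cps_coeff g b)"
    unfolding cps_coeff_mult
  proof (rule sum.mono_neutral_right[OF finite_antidiag])
    show "{(?a, ?b)} \<subseteq> antidiag (?a + ?b)" by (simp add: antidiag_def)
  qed (use unique in force)
  hence "cps_coeff (f * g) (?a + ?b) \<noteq> 0"
    using coeff_low_exp[OF nz(1)] coeff_low_exp[OF nz(2)] by simp
  thus "f * g \<noteq> 0" by auto
qed

text \<open>The value of the monomial with exponent \<open>a\<close> at the point whose coordinate for the variable \<open>v\<close> is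
  \<open>p\<^sub>v\<close> to the power \<open>-\<sigma>\<close>, where \<open>p\<^sub>v\<close> is the prime of \<open>v\<close>. These polydiscs shrink to the origin as \<open>\<sigma>\<close> grows, so
  convergence of a series can be tested on them; and for large \<open>\<sigma>\<close> the term of least weight dominates all
  others.\<close>

definition radius_pow :: "nat \<Rightarrow> ('n::finite) mexp \<Rightarrow> real" where
  "radius_pow \<sigma> a = (1 / real (weight a)) ^ \<sigma>"

lemma radius_pow_pos: "radius_pow \<sigma> a > 0"
  by (simp add: radius_pow_def weight_pos)

lemma radius_pow_nonneg [simp]: "radius_pow \<sigma> a \<ge> 0"
  using radius_pow_pos[of \<sigma> a] by simp

lemma radius_pow_plus: "radius_pow \<sigma> (a + b) = radius_pow \<sigma> a * radius_pow \<sigma> b"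
  by (simp add: radius_pow_def weight_add power_divide power_mult_distrib)

lemma var_prime_ge_2: "var_prime v \<ge> 2"
  using prime_var_prime prime_ge_2_nat by blast

lemma two_power_mdeg_le_weight: "2 ^ mdeg a \<le> weight a"
  unfolding mdeg_def weight_def power_sum
  by (intro prod_mono) (auto intro: power_mono var_prime_ge_2)

lemma weight_le_power_mdeg: "weight (a :: ('n::finite) mexp) \<le> (\<Sum>v::'n\<in>UNIV. var_prime v) ^ mdeg a"
  unfolding mdeg_def weight_def power_sum
  by (intro prod_mono) (auto intro!: power_mono member_le_sum)

lemma conv_series_radiusE:
  assumes "conv_series c"
  obtains \<sigma>\<^sub>0 B where
    "\<And>\<sigma> F. \<sigma> \<ge> \<sigma>\<^sub>0 \<Longrightarrow> finite F \<Longrightarrow> (\<Sum>a\<in>F. norm (c a) * radius_pow \<sigma> a) \<le> B"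
proof -
  from assms obtain r B where r: "r > 0" and
    B: "\<And>s F. 0 \<le> s \<Longrightarrow> s \<le> r \<Longrightarrow> finite F \<Longrightarrow> (\<Sum>a\<in>F. norm (c a) * s ^ mdeg a) \<le> B"
    using conv_seriesE[OF assms] by metis
  obtain \<sigma>\<^sub>0 where \<sigma>\<^sub>0: "(1 / 2 :: real) ^ \<sigma>\<^sub>0 < r"
    using real_arch_pow_inv[OF r, of "1 / 2"] by auto
  show thesis
  proof (rule that)
    fix \<sigma> and F :: "'a mexp set" assume "\<sigma> \<ge> \<sigma>\<^sub>0" "finite F"
    have "(1 / 2 :: real) ^ \<sigma> \<le> (1 / 2) ^ \<sigma>\<^sub>0" using \<open>\<sigma> \<ge> \<sigma>\<^sub>0\<close> by (intro power_decreasing) auto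
    hence "(1 / 2 :: real) ^ \<sigma> \<le> r" using \<sigma>\<^sub>0 by linarith
    have "radius_pow \<sigma> a \<le> ((1 / 2) ^ \<sigma>) ^ mdeg a" for a :: "'a mexp"
    proof -
      have "2 ^ mdeg a \<le> real (weight a)"
        using two_power_mdeg_le_weight[of a] by (metis of_nat_le_iff of_nat_numeral of_nat_power)
      hence "1 / real (weight a) \<le> (1 / 2) ^ mdeg a"
        by (simp add: power_divide weight_pos field_simps)
      thus ?thesis
        unfolding radius_pow_def power_mult[symmetric]
        by (subst mult.commute, subst power_mult) (intro power_mono, auto)
    qed
    hence "(\<Sum>a\<in>F. norm (c a) * radius_pow \<sigma> a) \<le> (\<Sum>a\<in>F. norm (c a) * ((1 / 2) ^ \<sigma>) ^ mdeg a)"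
      by (intro sum_mono mult_left_mono) auto
    also have "\<dots> \<le> B"
      using \<open>finite F\<close> \<open>(1 / 2) ^ \<sigma> \<le> r\<close> by (intro B) auto
    finally show "(\<Sum>a\<in>F. norm (c a) * radius_pow \<sigma> a) \<le> B" .
  qed
qed

lemma conv_series_radiusI:
  fixes c :: "('n::finite) mexp \<Rightarrow> complex"
  assumes "\<And>F. finite F \<Longrightarrow> (\<Sum>a\<in>F. norm (c a) * radius_pow \<sigma> a) \<le> B"
  shows "conv_series c"
proof -
  define M where "M = (\<Sum>v::'n\<in>UNIV. var_prime v)"
  have "var_prime v \<le> M" for v :: 'n unfolding M_def by (intro member_le_sum) auto
  hence M: "M > 0" using var_prime_ge_2 by (metis le_less_trans less_le_trans not_gr0 pos2 zero_less_iff_neq_zero)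
  show ?thesis
  proof (rule conv_seriesI)
    show "(1 / real M) ^ \<sigma> > 0" using M by simp
    fix F :: "'n mexp set" assume F: "finite F"
    have "((1 / real M) ^ \<sigma>) ^ mdeg a \<le> radius_pow \<sigma> a" for a :: "'n mexp"
    proof -
      have "real (weight a) \<le> real M ^ mdeg a"
        using weight_le_power_mdeg[of a] unfolding M_def[symmetric] by (metis of_nat_le_iff of_nat_power)
      hence "(1 / real M) ^ mdeg a \<le> 1 / real (weight a)"
        using M weight_pos[of a] by (simp add: power_divide field_simps)
      thus ?thesis
        unfolding radius_pow_def power_mult[symmetric]
        by (subst mult.commute, subst power_mult) (intro power_mono, auto)
    qed
    hence "(\<Sum>a\<in>F. norm (c a) * ((1 / real M) ^ \<sigma>) ^ mdeg a) \<le> (\<Sum>a\<in>F. norm (c a) * radius_pow \<sigma> a)"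
      by (intro sum_mono mult_left_mono) auto
    also have "\<dots> \<le> B" using F by (rule assms)
    finally show "(\<Sum>a\<in>F. norm (c a) * ((1 / real M) ^ \<sigma>) ^ mdeg a) \<le> B" .
  qed
qed

text \<open>Passing from the radius \<open>\<tau>\<close> to \<open>\<tau> + k\<close> divides the lowest term by \<open>w\<^sup>k\<close>, where \<open>w\<close> is its weight, and
  every other term by at least \<open>(w + 1)\<^sup>k\<close>.\<close>

lemma eventually_tail_le:
  fixes g :: "('n::finite) cps"
  assumes g: "g \<noteq> 0" and "\<epsilon> > 0"
  shows "\<forall>\<^sub>F \<sigma> in sequentially. \<forall>F. finite F \<longrightarrow> low_exp g \<notin> F \<longrightarrow>
    (\<Sum>a\<in>F. norm (cps_coeff g a) * radius_pow \<sigma> a) \<le> \<epsilon> * radius_pow \<sigma> (low_exp g)"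
proof -
  let ?e = "low_exp g"
  let ?w = "real (weight ?e)"
  have w: "?w > 0" by (simp add: weight_pos)
  have "conv_series (cps_coeff g)" using cps_coeff[of g] by simp
  then obtain \<tau> B where B: "\<And>F. finite F \<Longrightarrow>
      (\<Sum>a\<in>F. norm (cps_coeff g a) * radius_pow \<tau> a) \<le> B"
    using conv_series_radiusE by (metis order_refl)
  have "(\<lambda>k. B * (?w / (?w + 1)) ^ k) \<longlonglongrightarrow> B * 0"
    using w by (intro tendsto_mult tendsto_const LIMSEQ_realpow_zero) auto
  moreover have "B * 0 < \<epsilon> * radius_pow \<tau> ?e" using \<open>\<epsilon> > 0\<close> by (simp add: radius_pow_pos)
  ultimately have "\<forall>\<^sub>F k in sequentially. B * (?w / (?w + 1)) ^ k < \<epsilon> * radius_pow \<tau> ?e"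
    by (rule order_tendstoD)
  then obtain k0 where k0: "\<And>k. k \<ge> k0 \<Longrightarrow> B * (?w / (?w + 1)) ^ k < \<epsilon> * radius_pow \<tau> ?e"
    by (auto simp: eventually_sequentially)
  show ?thesis unfolding eventually_sequentially
  proof (intro exI[of _ "\<tau> + k0"] allI impI)
    fix \<sigma> F assume \<sigma>: "\<tau> + k0 \<le> \<sigma>" and F: "finite F" "?e \<notin> F"
    define k where "k = \<sigma> - \<tau>"
    have \<sigma>_eq: "\<sigma> = \<tau> + k" and k: "k \<ge> k0" using \<sigma> by (auto simp: k_def)
    have split: "radius_pow \<sigma> a = radius_pow \<tau> a * (1 / real (weight a)) ^ k" for a :: "'n mexp"
      by (simp add: radius_pow_def \<sigma>_eq power_add)
    have "(\<Sum>a\<in>F. norm (cps_coeff g a) * radius_pow \<sigma> a)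
        \<le> (\<Sum>a\<in>F. norm (cps_coeff g a) * radius_pow \<tau> a * (1 / (?w + 1)) ^ k)"
    proof (rule sum_mono)
      fix a assume "a \<in> F"
      show "norm (cps_coeff g a) * radius_pow \<sigma> a
          \<le> norm (cps_coeff g a) * radius_pow \<tau> a * (1 / (?w + 1)) ^ k"
      proof (cases "cps_coeff g a = 0")
        case False
        have "weight ?e \<noteq> weight a" using \<open>a \<in> F\<close> F by auto
        with weight_low_exp_le[OF g False] have "?w + 1 \<le> real (weight a)" by linarith
        hence "(1 / real (weight a)) ^ k \<le> (1 / (?w + 1)) ^ k"
          using w by (intro power_mono divide_left_mono) auto
        thus ?thesis unfolding split mult.assoc by (intro mult_left_mono) auto
      qed simp
    qed
    also have "\<dots> = (\<Sum>a\<in>F. norm (cps_coeff g a) * radius_pow \<tau> a) * (1 / (?w + 1)) ^ k"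
      by (simp only: sum_distrib_right)
    also have "\<dots> \<le> B * (1 / (?w + 1)) ^ k"
      using F w by (intro mult_right_mono B) auto
    also have "\<dots> = B * (?w / (?w + 1)) ^ k * (1 / ?w) ^ k"
      using w by (simp add: power_divide)
    also have "\<dots> \<le> \<epsilon> * radius_pow \<tau> ?e * (1 / ?w) ^ k"
      using k0[OF k] w by (intro mult_right_mono) auto
    also have "\<dots> = \<epsilon> * radius_pow \<sigma> ?e" by (simp add: split)
    finally show "(\<Sum>a\<in>F. norm (cps_coeff g a) * radius_pow \<sigma> a) \<le> \<epsilon> * radius_pow \<sigma> ?e" .
  qed
qed

definition cps_monom :: "'n mexp \<Rightarrow> complex \<Rightarrow> ('n::finite) cps" where
  "cps_monom d z = Abs_cps (\<lambda>a. if a = d then z else 0)"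

lemma coeff_monom: "cps_coeff (cps_monom d z) a = (if a = d then z else 0)"
  unfolding cps_monom_def by (subst Abs_cps_inverse) (auto simp: conv_series_single)

lemma coeff_monom_mult:
  "cps_coeff (cps_monom d z * g) a = (\<Sum>(d', x)\<in>antidiag a. if d' = d then z * cps_coeff g x else 0)"
  unfolding cps_coeff_mult coeff_monom by (intro sum.cong) auto

lemma coeff_monom_mult_plus [simp]: "cps_coeff (cps_monom d z * g) (d + x) = z * cps_coeff g x"
proof -
  have "cps_coeff (cps_monom d z * g) (d + x) =
      (\<Sum>(d', x)\<in>{(d, x)}. if d' = d then z * cps_coeff g x else 0)"
    unfolding coeff_monom_mult
    by (intro sum.mono_neutral_right finite_antidiag) (auto simp: antidiag_def split: if_splits)
  thus ?thesis by simp
qed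

lemma coeff_monom_mult_neq:
  assumes "\<nexists>x. a = d + x"
  shows "cps_coeff (cps_monom d z * g) a = 0"
  unfolding coeff_monom_mult using assms by (intro sum.neutral) (auto simp: antidiag_def)

text \<open>The coefficients of \<open>h\<close> in a system of series \<open>b c\<close>, indexed by exponents \<open>c\<close>, that start with the
  monomial \<open>c\<close> and continue in larger weights. Solving for them is a recursion on the weight.\<close>

function triangular_solution ::
  "(('n::finite) mexp \<Rightarrow> complex) \<Rightarrow> ('n mexp \<Rightarrow> 'n mexp \<Rightarrow> complex) \<Rightarrow> 'n mexp \<Rightarrow> complex" where
  "triangular_solution h b a =
     h a - (\<Sum>c\<in>{c. weight c < weight a}. triangular_solution h b c * b c a)"
  by auto
termination by (relation "measure (\<lambda>(h, b, a). weight a)") auto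

declare triangular_solution.simps [simp del]

lemma triangular_solution:
  fixes h :: "('n::finite) mexp \<Rightarrow> complex"
  assumes "b a a = 1"
  shows "h a = (\<Sum>c\<in>{c. weight c \<le> weight a}. triangular_solution h b c * b c a)"
proof -
  have "{c. weight c \<le> weight a} = insert a {c. weight c < weight a}"
    by (auto simp: order.order_iff_strict)
  moreover have "finite {c :: 'n mexp. weight c < weight a}"
    by (rule finite_subset[OF _ finite_weight_le[of "weight a"]]) auto
  ultimately show ?thesis
    using assms by (simp add: triangular_solution.simps[of h b a])
qed

text \<open>If the tail of every \<open>b c\<close> has at most half the norm of its leading monomial, then the norm \<open>U\<close> of the
  solution satisfies \<open>U \<le> H + U / 2\<close>. Truncating at a weight makes \<open>U\<close> a finite sum, so it may be
  subtracted.\<close>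

lemma triangular_solution_bound:
  fixes h :: "('n::finite) mexp \<Rightarrow> complex"
  assumes h: "\<And>F. finite F \<Longrightarrow> (\<Sum>a\<in>F. norm (h a) * radius_pow \<sigma> a) \<le> H"
    and tail: "\<And>c F. finite F \<Longrightarrow> c \<notin> F \<Longrightarrow>
      (\<Sum>a\<in>F. norm (b c a) * radius_pow \<sigma> a) \<le> radius_pow \<sigma> c / 2"
    and "finite F"
  shows "(\<Sum>a\<in>F. norm (triangular_solution h b a) * radius_pow \<sigma> a) \<le> 2 * H"
proof -
  let ?u = "triangular_solution h b"
  let ?\<rho> = "radius_pow \<sigma> :: 'n mexp \<Rightarrow> real"
  define N where "N = Max (insert 0 (weight ` F))"
  define A where "A = {a :: 'n mexp. weight a \<le> N}"
  have fin: "finite A" "finite {c \<in> A. weight c < weight a}" "finite {c \<in> A. weight a < weight c}" for a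
    unfolding A_def using finite_weight_le[of N] by auto
  have FA: "F \<subseteq> A" unfolding A_def N_def using \<open>finite F\<close> by auto
  let ?S = "\<Sum>a\<in>A. norm (?u a) * ?\<rho> a"
  have "?S \<le> (\<Sum>a\<in>A. norm (h a) * ?\<rho> a + (\<Sum>c\<in>{c \<in> A. weight c < weight a}. norm (?u c) * (norm (b c a) * ?\<rho> a)))"
  proof (rule sum_mono)
    fix a assume "a \<in> A"
    hence eq: "{c. weight c < weight a} = {c \<in> A. weight c < weight a}" by (auto simp: A_def)
    have "norm (?u a) \<le> norm (h a) + norm (\<Sum>c\<in>{c \<in> A. weight c < weight a}. ?u c * b c a)"
      unfolding triangular_solution.simps[of h b a] eq by (rule norm_triangle_ineq4)
    also have "norm (\<Sum>c\<in>{c \<in> A. weight c < weight a}. ?u c * b c a)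
        \<le> (\<Sum>c\<in>{c \<in> A. weight c < weight a}. norm (?u c) * norm (b c a))"
      by (rule order_trans[OF norm_sum]) (simp add: norm_mult)
    finally have "norm (?u a) * ?\<rho> a \<le>
        (norm (h a) + (\<Sum>c\<in>{c \<in> A. weight c < weight a}. norm (?u c) * norm (b c a))) * ?\<rho> a"
      by (intro mult_right_mono) auto
    thus "norm (?u a) * ?\<rho> a \<le> norm (h a) * ?\<rho> a +
        (\<Sum>c\<in>{c \<in> A. weight c < weight a}. norm (?u c) * (norm (b c a) * ?\<rho> a))"
      by (simp add: distrib_right sum_distrib_right mult.assoc)
  qed
  also have "\<dots> = (\<Sum>a\<in>A. norm (h a) * ?\<rho> a) +
      (\<Sum>a\<in>A. \<Sum>c\<in>{c \<in> A. weight c < weight a}. norm (?u c) * (norm (b c a) * ?\<rho> a))"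
    by (rule sum.distrib)
  also have "(\<Sum>a\<in>A. \<Sum>c\<in>{c \<in> A. weight c < weight a}. norm (?u c) * (norm (b c a) * ?\<rho> a)) =
      (\<Sum>c\<in>A. norm (?u c) * (\<Sum>a\<in>{a \<in> A. weight c < weight a}. norm (b c a) * ?\<rho> a))"
    unfolding sum_distrib_left by (rule sum.swap_restrict) (rule fin)+
  also have "\<dots> \<le> (\<Sum>c\<in>A. norm (?u c) * (?\<rho> c / 2))"
    using fin by (intro sum_mono mult_left_mono tail) auto
  also have "\<dots> = ?S / 2" by (simp add: sum_divide_distrib)
  also have "(\<Sum>a\<in>A. norm (h a) * ?\<rho> a) \<le> H" using fin by (intro h)
  finally have "?S \<le> 2 * H" by simp
  moreover have "(\<Sum>a\<in>F. norm (?u a) * ?\<rho> a) \<le> ?S"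
    by (intro sum_mono2 fin FA) auto
  ultimately show ?thesis by linarith
qed


text \<open>Grauert's division theorem. Every exponent \<open>c\<close> divisible by some \<open>low_exp g\<close> is assigned to one such
  \<open>g\<close>, and \<open>b c\<close> is the monomial multiple of \<open>g\<close> that starts at \<open>c\<close>; every other \<open>c\<close> keeps its own monomial.
  Expanding \<open>h\<close> in this triangular system and collecting the terms that belong to \<open>g\<close> gives the quotient
  of \<open>g\<close>, and the remaining terms give the remainder. Choosing \<open>\<sigma>\<close> so large that the tails of the finitely
  many \<open>g\<close> are small makes all these series converge.\<close>

theorem convergent_division:
  fixes h :: "('n::finite) cps"
  assumes G: "finite G" "0 \<notin> G"
  obtains q r where "h = (\<Sum>g\<in>G. q g * g) + r"
    and "\<And>g d. g \<in> G \<Longrightarrow> cps_coeff r (d + low_exp g) = 0"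
proof -
  define M where "M = {a. \<exists>g\<in>G. \<exists>d. a = d + low_exp g}"
  have "\<forall>a\<in>M. \<exists>g d. g \<in> G \<and> a = d + low_exp g" by (auto simp: M_def)
  then obtain \<gamma> \<delta> where \<gamma>: "\<And>a. a \<in> M \<Longrightarrow> \<gamma> a \<in> G" "\<And>a. a \<in> M \<Longrightarrow> a = \<delta> a + low_exp (\<gamma> a)"
    by metis
  define lc where "lc g = cps_coeff g (low_exp g)" for g :: "'n cps"
  have lc: "lc g \<noteq> 0" if "g \<in> G" for g
    unfolding lc_def using that G(2) by (intro coeff_low_exp) auto
  define b where "b c = (if c \<in> M then cps_monom (\<delta> c) (1 / lc (\<gamma> c)) * \<gamma> c else cps_monom c 1)" for c
  define u where "u = triangular_solution (cps_coeff h) (\<lambda>c. cps_coeff (b c))"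
  have b_plus: "cps_coeff (b c) (\<delta> c + x) = cps_coeff (\<gamma> c) x / lc (\<gamma> c)" if "c \<in> M" for c x
    using that by (simp add: b_def)
  have b_diag: "cps_coeff (b c) c = 1" for c
  proof (cases "c \<in> M")
    case True
    hence "cps_coeff (b c) (\<delta> c + low_exp (\<gamma> c)) = 1"
      using lc[OF \<gamma>(1)[OF True]] by (simp only: b_plus lc_def[symmetric]) simp
    thus ?thesis using \<gamma>(2)[OF True] by simp
  qed (simp add: b_def coeff_monom)
  have "\<forall>\<^sub>F \<sigma> in sequentially. \<forall>g\<in>G. \<forall>F. finite F \<longrightarrow> low_exp g \<notin> F \<longrightarrow>
    (\<Sum>a\<in>F. norm (cps_coeff g a) * radius_pow \<sigma> a) \<le> norm (lc g) / 2 * radius_pow \<sigma> (low_exp g)"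
    using G(2) lc by (intro eventually_ball_finite G(1) ballI eventually_tail_le) auto
  moreover obtain H where "\<forall>\<^sub>F \<sigma> in sequentially. \<forall>F. finite F \<longrightarrow>
      (\<Sum>a\<in>F. norm (cps_coeff h a) * radius_pow \<sigma> a) \<le> H"
  proof -
    have "conv_series (cps_coeff h)" using cps_coeff[of h] by simp
    then obtain \<tau> H where "\<And>\<sigma> F. \<sigma> \<ge> \<tau> \<Longrightarrow> finite F \<Longrightarrow>
        (\<Sum>a\<in>F. norm (cps_coeff h a) * radius_pow \<sigma> a) \<le> H"
      using conv_series_radiusE by metis
    thus thesis by (intro that[of H]) (auto simp: eventually_sequentially)
  qed
  ultimately have "\<forall>\<^sub>F \<sigma> in sequentially. (\<forall>g\<in>G. \<forall>F. finite F \<longrightarrow> low_exp g \<notin> F \<longrightarrow>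
      (\<Sum>a\<in>F. norm (cps_coeff g a) * radius_pow \<sigma> a) \<le> norm (lc g) / 2 * radius_pow \<sigma> (low_exp g)) \<and>
    (\<forall>F. finite F \<longrightarrow> (\<Sum>a\<in>F. norm (cps_coeff h a) * radius_pow \<sigma> a) \<le> H)"
    by (rule eventually_conj)
  from eventually_happens'[OF sequentially_bot this] obtain \<sigma> where
    tail: "\<And>g F. g \<in> G \<Longrightarrow> finite F \<Longrightarrow> low_exp g \<notin> F \<Longrightarrow>
      (\<Sum>a\<in>F. norm (cps_coeff g a) * radius_pow \<sigma> a) \<le> norm (lc g) / 2 * radius_pow \<sigma> (low_exp g)"
    and H: "\<And>F. finite F \<Longrightarrow> (\<Sum>a\<in>F. norm (cps_coeff h a) * radius_pow \<sigma> a) \<le> H"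
    by blast
  have b_tail: "(\<Sum>a\<in>F. norm (cps_coeff (b c) a) * radius_pow \<sigma> a) \<le> radius_pow \<sigma> c / 2"
    if F: "finite F" "c \<notin> F" for c F
  proof (cases "c \<in> M")
    case True
    define g where "g = \<gamma> c"
    have g: "g \<in> G" "c = \<delta> c + low_exp g" using \<gamma>[OF True] by (auto simp: g_def)
    let ?X = "{x. \<delta> c + x \<in> F}"
    have X: "finite ?X" "low_exp g \<notin> ?X"
      using F g(2) finite_vimageI[OF F(1), of "\<lambda>x. \<delta> c + x"] by (auto simp: vimage_def inj_def)
    have "(\<Sum>a\<in>F. norm (cps_coeff (b c) a) * radius_pow \<sigma> a) =
        (\<Sum>a\<in>(\<lambda>x. \<delta> c + x) ` ?X. norm (cps_coeff (b c) a) * radius_pow \<sigma> a)"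
    proof (rule sum.mono_neutral_right[OF F(1)])
      show "\<forall>a\<in>F - (\<lambda>x. \<delta> c + x) ` ?X. norm (cps_coeff (b c) a) * radius_pow \<sigma> a = 0"
        using True by (auto simp: b_def intro!: coeff_monom_mult_neq)
    qed auto
    also have "\<dots> = (\<Sum>x\<in>?X. norm (cps_coeff (b c) (\<delta> c + x)) * radius_pow \<sigma> (\<delta> c + x))"
      by (subst sum.reindex) (auto simp: inj_on_def)
    also have "\<dots> = radius_pow \<sigma> (\<delta> c) / norm (lc g) * (\<Sum>x\<in>?X. norm (cps_coeff g x) * radius_pow \<sigma> x)"
      unfolding sum_distrib_left
      by (intro sum.cong) (simp_all add: b_plus[OF True] norm_divide radius_pow_plus g_def)
    also have "\<dots> \<le> radius_pow \<sigma> (\<delta> c) / norm (lc g) * (norm (lc g) / 2 * radius_pow \<sigma> (low_exp g))"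
      using X g(1) by (intro mult_left_mono tail) auto
    also have "\<dots> = radius_pow \<sigma> c / 2"
      using lc[OF g(1)] by (subst (2) g(2)) (simp add: radius_pow_plus)
    finally show ?thesis .
  next
    case False
    have "(\<Sum>a\<in>F. norm (cps_coeff (b c) a) * radius_pow \<sigma> a) = 0"
      using False F by (intro sum.neutral) (auto simp: b_def coeff_monom)
    thus ?thesis by simp
  qed
  have u_bound: "(\<Sum>a\<in>F. norm (u a) * radius_pow \<sigma> a) \<le> 2 * H" if "finite F" for F
    unfolding u_def by (intro triangular_solution_bound H b_tail that)
  define q' where "q' g d = (if d + low_exp g \<in> M \<and> \<gamma> (d + low_exp g) = g
      then u (d + low_exp g) / lc g else 0)" for g :: "'n cps" and d
  have "conv_series (q' g)" if g: "g \<in> G" for g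
  proof (rule conv_series_radiusI)
    fix F :: "'n mexp set" assume F: "finite F"
    let ?\<rho> = "radius_pow \<sigma> :: 'n mexp \<Rightarrow> real" and ?e = "low_exp g"
    have "(\<Sum>d\<in>F. norm (q' g d) * ?\<rho> d)
        \<le> (\<Sum>d\<in>F. norm (u (d + ?e)) * ?\<rho> (d + ?e) / (norm (lc g) * ?\<rho> ?e))"
      using lc[OF g] radius_pow_pos[of \<sigma> ?e]
      by (intro sum_mono) (auto simp: q'_def radius_pow_plus norm_divide)
    also have "\<dots> = (\<Sum>a\<in>(\<lambda>d. d + ?e) ` F. norm (u a) * ?\<rho> a) / (norm (lc g) * ?\<rho> ?e)"
      by (subst sum.reindex) (auto simp: inj_on_def sum_divide_distrib)
    also have "\<dots> \<le> 2 * H / (norm (lc g) * ?\<rho> ?e)"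
      using F by (intro divide_right_mono u_bound) auto
    finally show "(\<Sum>d\<in>F. norm (q' g d) * ?\<rho> d) \<le> 2 * H / (norm (lc g) * ?\<rho> ?e)" .
  qed
  then have q: "cps_coeff (Abs_cps (q' g)) = q' g" if "g \<in> G" for g
    using that by (simp add: Abs_cps_inverse)
  define r' where "r' a = (if a \<in> M then 0 else u a)" for a
  have "conv_series r'"
  proof (rule conv_series_radiusI)
    fix F :: "'n mexp set" assume F: "finite F"
    have "(\<Sum>a\<in>F. norm (r' a) * radius_pow \<sigma> a) \<le> (\<Sum>a\<in>F. norm (u a) * radius_pow \<sigma> a)"
      by (intro sum_mono) (auto simp: r'_def)
    also have "\<dots> \<le> 2 * H" using F by (rule u_bound)
    finally show "(\<Sum>a\<in>F. norm (r' a) * radius_pow \<sigma> a) \<le> 2 * H" .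
  qed
  hence r: "cps_coeff (Abs_cps r') = r'" by (simp add: Abs_cps_inverse)
  show thesis
  proof (rule that)
    show "cps_coeff (Abs_cps r') (d + low_exp g) = 0" if "g \<in> G" for g d
      using that unfolding r by (auto simp: r'_def M_def)
    show "h = (\<Sum>g\<in>G. Abs_cps (q' g) * g) + Abs_cps r'"
    proof (rule cps_eqI)
      fix a :: "'n mexp"
      \<comment> \<open>Only exponents of weight at most that of \<open>a\<close> contribute to the coefficient at \<open>a\<close>.\<close>
      define C where "C = {c :: 'n mexp. weight c \<le> weight a}"
      have finC: "finite C" unfolding C_def by (rule finite_weight_le)
      have quotient: "cps_coeff (Abs_cps (q' g) * g) a = (\<Sum>c\<in>{c\<in>C \<inter> M. \<gamma> c = g}. u c * cps_coeff (b c) a)"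
        if g: "g \<in> G" for g
      proof -
        let ?D = "{c\<in>C \<inter> M. \<gamma> c = g}"
        have "(\<Sum>c\<in>?D. u c * cps_coeff (b c) a) =
            (\<Sum>c\<in>?D. \<Sum>(d, x)\<in>antidiag a. if d = \<delta> c then u c / lc g * cps_coeff g x else 0)"
          by (intro sum.cong refl, simp add: b_def coeff_monom_mult sum_distrib_left case_prod_unfold)
             (intro sum.cong refl, auto)
        also have "\<dots> = (\<Sum>(d, x)\<in>antidiag a. \<Sum>c\<in>?D. if d = \<delta> c then u c / lc g * cps_coeff g x else 0)"
          unfolding case_prod_unfold by (rule sum.swap)
        also have "\<dots> = (\<Sum>(d, x)\<in>antidiag a. q' g d * cps_coeff g x)"
        proof (rule sum.cong[OF refl], clarify)
          fix d x assume dx: "(d, x) \<in> antidiag a"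
          have "(\<Sum>c\<in>?D. if d = \<delta> c then u c / lc g * cps_coeff g x else 0) =
              (\<Sum>c\<in>?D. if c = d + low_exp g then u c / lc g * cps_coeff g x else 0)"
          proof (intro sum.cong refl)
            fix c assume "c \<in> ?D"
            hence "c = \<delta> c + low_exp g" using \<gamma>(2)[of c] by simp
            hence "d = \<delta> c \<longleftrightarrow> c = d + low_exp g" by (metis add_right_cancel)
            thus "(if d = \<delta> c then u c / lc g * cps_coeff g x else 0) =
                (if c = d + low_exp g then u c / lc g * cps_coeff g x else 0)" by simp
          qed
          also have "\<dots> = (if d + low_exp g \<in> ?D then u (d + low_exp g) / lc g * cps_coeff g x else 0)"
            using finC by (subst sum.delta) auto
          also have "\<dots> = q' g d * cps_coeff g x"
          proof (cases "cps_coeff g x = 0")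
            case False
            have "weight (low_exp g) \<le> weight x" using g G(2) False by (intro weight_low_exp_le) auto
            hence "weight (d + low_exp g) \<le> weight a"
              using dx by (auto simp: antidiag_def weight_add)
            thus ?thesis by (auto simp: q'_def C_def)
          qed simp
          finally show "(\<Sum>c\<in>?D. if d = \<delta> c then u c / lc g * cps_coeff g x else 0) =
              q' g d * cps_coeff g x" .
        qed
        finally show ?thesis unfolding cps_coeff_mult q[OF g] by simp
      qed
      have "cps_coeff h a = (\<Sum>c\<in>C. u c * cps_coeff (b c) a)"
        unfolding C_def u_def by (rule triangular_solution) (rule b_diag)
      also have "\<dots> = (\<Sum>c\<in>C \<inter> M. u c * cps_coeff (b c) a) + (\<Sum>c\<in>C - M. u c * cps_coeff (b c) a)"
        using finC by (rule sum.Int_Diff)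
      also have "(\<Sum>c\<in>C - M. u c * cps_coeff (b c) a) = (\<Sum>c\<in>C - M. if c = a then u c else 0)"
        by (intro sum.cong) (auto simp: b_def coeff_monom)
      also have "\<dots> = r' a" using finC by (simp add: r'_def C_def)
      also have "(\<Sum>c\<in>C \<inter> M. u c * cps_coeff (b c) a) =
          (\<Sum>g\<in>G. \<Sum>c\<in>{c\<in>C \<inter> M. \<gamma> c = g}. u c * cps_coeff (b c) a)"
        using finC \<gamma>(1) G(1) by (intro sum.group[symmetric]) auto
      also have "\<dots> = (\<Sum>g\<in>G. cps_coeff (Abs_cps (q' g) * g) a)"
        by (intro sum.cong) (simp_all add: quotient)
      finally show "cps_coeff h a = cps_coeff ((\<Sum>g\<in>G. Abs_cps (q' g) * g) + Abs_cps r') a"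
        by (simp add: cps_coeff_sum r)
    qed
  qed
qed

text \<open>Division of an element of the ideal by series whose lowest exponents generate all lowest exponents of
  the ideal leaves the remainder zero: the remainder is in the ideal, yet has no coefficient at any
  lowest exponent of the ideal.\<close>

theorem noetherian_cps: "noetherian TYPE(('n::finite) cps)"
  unfolding noetherian_def
proof (intro allI impI)
  fix I :: "'n cps set" assume I: "ideals.subspace I"
  obtain T where T: "finite T" "T \<subseteq> low_exp ` (I - {0})"
    "\<And>s. s \<in> low_exp ` (I - {0}) \<Longrightarrow> \<exists>t\<in>T. \<exists>d. s = d + t"
    by (rule Dickson_basis) blast
  then obtain G where G: "finite G" "G \<subseteq> I - {0}" "T = low_exp ` G"
    by (metis finite_subset_image)
  have "h \<in> ideals.span G" if "h \<in> I" for h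
  proof -
    obtain q r where qr: "h = (\<Sum>g\<in>G. q g * g) + r"
      "\<And>g d. g \<in> G \<Longrightarrow> cps_coeff r (d + low_exp g) = 0"
      using convergent_division[of G h] G(1,2) by blast
    have "r = h - (\<Sum>g\<in>G. q g * g)" using qr(1) by simp
    moreover have "(\<Sum>g\<in>G. q g * g) \<in> I"
      using G(2) by (intro ideals.subspace_sum[OF I] ideals.subspace_scale[OF I]) auto
    ultimately have "r \<in> I" using that ideals.subspace_diff[OF I] by simp
    have "r = 0"
    proof (rule ccontr)
      assume "r \<noteq> 0"
      with \<open>r \<in> I\<close> T(3)[of "low_exp r"] G(3) obtain g d where "g \<in> G" "low_exp r = d + low_exp g"
        by auto
      thus False using qr(2)[of g d] coeff_low_exp[OF \<open>r \<noteq> 0\<close>] by simp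
    qed
    moreover have "(\<Sum>g\<in>G. q g * g) \<in> ideals.span G"
      by (intro ideals.span_sum ideals.span_scale ideals.span_base)
    ultimately show ?thesis using qr(1) by simp
  qed
  moreover have "ideals.span G \<subseteq> I" using G(2) I by (intro ideals.span_minimal) auto
  ultimately have "ideals.span G = I" by blast
  thus "\<exists>B. finite B \<and> ideals.span B = I" using G(1) by blast
qed

section \<open>Heights of primes and algebraic dependence\<close>

text \<open>More vectors than coordinates: Gaussian elimination with a pivot \<open>p\<close>, without division, so that it
  works over a domain.\<close>

lemma nontrivial_linear_relation:
  fixes v :: "'e \<Rightarrow> 'b \<Rightarrow> 'a::idom"
  assumes "finite B" "finite E" "card B < card E"
  shows "\<exists>c. (\<exists>e\<in>E. c e \<noteq> 0) \<and> (\<forall>b\<in>B. (\<Sum>e\<in>E. c e * v e b) = 0)"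
  using assms
proof (induction B arbitrary: E v)
  case empty
  then obtain e where "e \<in> E" by fastforce
  thus ?case by (intro exI[of _ "\<lambda>_. 1"]) auto
next
  case (insert b B)
  show ?case
  proof (cases "\<forall>e\<in>E. v e b = 0")
    case True
    from insert.IH[of E v] insert.prems insert.hyps obtain c
      where c: "\<exists>e\<in>E. c e \<noteq> 0" "\<forall>b\<in>B. (\<Sum>e\<in>E. c e * v e b) = 0" by auto
    thus ?thesis using True by (intro exI[of _ c]) auto
  next
    case False
    then obtain p where p: "p \<in> E" "v p b \<noteq> 0" by blast
    define w where "w e x = v p b * v e x - v e b * v p x" for e x
    have "finite (E - {p})" "card B < card (E - {p})" using insert.prems insert.hyps p by simp_all
    from insert.IH[OF this, of w] obtain c
      where c: "\<exists>e\<in>E - {p}. c e \<noteq> 0" "\<And>x. x \<in> B \<Longrightarrow> (\<Sum>e\<in>E - {p}. c e * w e x) = 0"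
      by blast
    define d where "d e = (if e = p then - (\<Sum>e\<in>E - {p}. c e * v e b) else c e * v p b)" for e
    have "(\<Sum>e\<in>E. d e * v e x) = (\<Sum>e\<in>E - {p}. c e * w e x)" for x
    proof -
      have "(\<Sum>e\<in>E. d e * v e x) = d p * v p x + (\<Sum>e\<in>E - {p}. d e * v e x)"
        using insert.prems p by (intro sum.remove) auto
      also have "\<dots> = (\<Sum>e\<in>E - {p}. c e * v p b * v e x - c e * v e b * v p x)"
        by (simp add: d_def sum_subtractf sum_distrib_right)
      also have "\<dots> = (\<Sum>e\<in>E - {p}. c e * w e x)"
        by (simp add: w_def algebra_simps)
      finally show ?thesis .
    qed
    moreover have "(\<Sum>e\<in>E - {p}. c e * w e b) = 0" by (simp add: w_def mult.commute)
    moreover have "\<exists>e\<in>E. d e \<noteq> 0" using c(1) p by (auto simp: d_def)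
    ultimately show ?thesis using c(2) by (intro exI[of _ d]) auto
  qed
qed

definition degree_le :: "nat \<Rightarrow> (('v::finite) mexp \<Rightarrow>\<^sub>0 'a::zero) \<Rightarrow> bool" where
  "degree_le d p \<longleftrightarrow> (\<forall>a\<in>Poly_Mapping.keys p. mdeg a \<le> d)"

lemma degree_le_mult:
  fixes p q :: "('v::finite) mexp \<Rightarrow>\<^sub>0 'a::comm_ring_1"
  assumes "degree_le d p" "degree_le e q"
  shows "degree_le (d + e) (p * q)"
  using keys_mult[of p q] assms unfolding degree_le_def
  by (force simp: mdeg_add intro: add_mono)

lemma degree_le_1: "degree_le 0 (1 :: ('v::finite) mexp \<Rightarrow>\<^sub>0 'a::comm_ring_1)"
  by (simp add: degree_le_def)

lemma degree_le_power:
  fixes p :: "('v::finite) mexp \<Rightarrow>\<^sub>0 'a::comm_ring_1"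
  assumes "degree_le d p"
  shows "degree_le (k * d) (p ^ k)"
  by (induction k) (auto intro: degree_le_mult assms degree_le_1)

lemma degree_le_prod:
  fixes p :: "'i \<Rightarrow> ('v::finite) mexp \<Rightarrow>\<^sub>0 'a::comm_ring_1"
  assumes "\<And>i. i \<in> A \<Longrightarrow> degree_le (d i) (p i)"
  shows "degree_le (sum d A) (prod p A)"
  using assms by (induction A rule: infinite_finite_induct) (auto intro: degree_le_mult degree_le_1)

lemma finite_mdeg_le: "finite {a :: ('v::finite) mexp. mdeg a \<le> d}"
  and card_mdeg_le: "card {a :: ('v::finite) mexp. mdeg a \<le> d} \<le> (d + 1) ^ CARD('v)"
proof -
  let ?L = "Poly_Mapping.lookup :: 'v mexp \<Rightarrow> 'v \<Rightarrow> nat"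
  let ?S = "{a :: 'v mexp. mdeg a \<le> d}"
  have "?L a v \<le> mdeg a" for a v unfolding mdeg_def by (rule member_le_sum) auto
  hence sub: "?L ` ?S \<subseteq> Pi\<^sub>E UNIV (\<lambda>v. {..d})" by (auto intro: order_trans)
  have inj: "inj_on ?L ?S" by (auto simp: inj_on_def poly_mapping_eqI)
  have fin: "finite (Pi\<^sub>E (UNIV :: 'v set) (\<lambda>v. {..d}))" by (intro finite_PiE) auto
  show "finite ?S" using finite_subset[OF sub fin] inj by (rule finite_imageD)
  have "card ?S = card (?L ` ?S)" using inj by (simp add: card_image)
  also have "\<dots> \<le> card (Pi\<^sub>E (UNIV :: 'v set) (\<lambda>v. {..d}))" by (intro card_mono sub fin)
  also have "\<dots> = (d + 1) ^ CARD('v)" by (simp add: card_PiE)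
  finally show "card ?S \<le> (d + 1) ^ CARD('v)" .
qed

text \<open>If all \<open>y i\<close> have degree at most \<open>d\<close>, the \<open>m\<^sup>k\<close> monomials in the \<open>y i\<close> with exponents below \<open>m\<close> have degree
  at most \<open>k m d\<close>. They lie in a free module whose rank grows like the power of \<open>m\<close> given by the number
  of variables, which is less than \<open>k\<close>. For large \<open>m\<close> they are linearly dependent.\<close>

theorem algebraic_relation:
  fixes y :: "nat \<Rightarrow> ('v::finite) mexp \<Rightarrow>\<^sub>0 'a::idom"
  assumes k: "CARD('v) < k"
  obtains E c where "finite E" "E \<noteq> {}" "E \<subseteq> Pi\<^sub>E {..<k} (\<lambda>_. UNIV)" "\<forall>e\<in>E. c e \<noteq> 0"
    "(\<Sum>e\<in>E. Poly_Mapping.single 0 (c e) * (\<Prod>i<k. y i ^ e i)) = 0"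
proof -
  have "\<exists>d. \<forall>i<k. degree_le d (y i)"
  proof -
    define d where "d = Max (insert 0 (mdeg ` (\<Union>i<k. Poly_Mapping.keys (y i))))"
    have "degree_le d (y i)" if "i < k" for i
      unfolding degree_le_def d_def using that by (auto intro!: Max_ge)
    thus ?thesis by blast
  qed
  then obtain d where d: "\<And>i. i < k \<Longrightarrow> degree_le d (y i)" by blast
  \<comment> \<open>With \<open>r\<close> variables there are at most \<open>(D m)\<^sup>r\<close> monomials of degree at most \<open>k m d\<close>, and
      \<open>m > D\<^sup>r\<close> makes this smaller than \<open>m\<close> to the power \<open>r + 1\<close>.\<close>
  define D where "D = k * d + 1"
  define m where "m = D ^ CARD('v) + 1"
  have m: "m > 0" "D > 0" by (auto simp: m_def D_def)
  define F where "F = Pi\<^sub>E {..<k} (\<lambda>_. {..<m})"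
  define B where "B = {a :: 'v mexp. mdeg a \<le> k * (m * d)}"
  define Y where "Y e = (\<Prod>i<k. y i ^ e i)" for e
  have finF: "finite F" unfolding F_def by (intro finite_PiE) auto
  have finB: "finite B" unfolding B_def by (rule finite_mdeg_le)
  have "card B \<le> (k * (m * d) + 1) ^ CARD('v)" unfolding B_def by (rule card_mdeg_le)
  also have "\<dots> \<le> (D * m) ^ CARD('v)"
    using m by (intro power_mono) (auto simp: D_def algebra_simps)
  also have "\<dots> = D ^ CARD('v) * m ^ CARD('v)" by (rule power_mult_distrib)
  also have "\<dots> < m * m ^ CARD('v)" using m by (intro mult_strict_right_mono) (auto simp: m_def)
  also have "\<dots> = m ^ Suc (CARD('v))" by simp
  also have "\<dots> \<le> m ^ k" using k m by (intro power_increasing) auto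
  also have "\<dots> = card F" unfolding F_def by (simp add: card_PiE)
  finally have "card B < card F" .
  from nontrivial_linear_relation[OF finB finF this, of "\<lambda>e. Poly_Mapping.lookup (Y e)"] obtain c
    where c: "\<exists>e\<in>F. c e \<noteq> 0" "\<And>a. a \<in> B \<Longrightarrow> (\<Sum>e\<in>F. c e * Poly_Mapping.lookup (Y e) a) = 0"
    by blast
  have keysY: "Poly_Mapping.keys (Y e) \<subseteq> B" if e: "e \<in> F" for e
  proof -
    have "degree_le (\<Sum>i<k. e i * d) (Y e)"
      unfolding Y_def by (intro degree_le_prod degree_le_power d) auto
    moreover have "(\<Sum>i<k. e i * d) \<le> (\<Sum>i<k. m * d)"
      using e by (intro sum_mono mult_right_mono) (auto simp: F_def PiE_iff intro: less_imp_le)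
    ultimately show ?thesis unfolding degree_le_def B_def by (auto intro: order_trans)
  qed
  define E where "E = {e \<in> F. c e \<noteq> 0}"
  have lookup_const: "Poly_Mapping.lookup (Poly_Mapping.single 0 z * p) a = z * Poly_Mapping.lookup p a"
    for z :: 'a and p :: "'v mexp \<Rightarrow>\<^sub>0 'a" and a
    using lookup_single_times[of 0 z p a] by simp
  have "(\<Sum>e\<in>E. Poly_Mapping.single 0 (c e) * Y e) = 0"
  proof (rule poly_mapping_eqI)
    fix a
    have "Poly_Mapping.lookup (\<Sum>e\<in>E. Poly_Mapping.single 0 (c e) * Y e) a =
        (\<Sum>e\<in>E. c e * Poly_Mapping.lookup (Y e) a)"
      by (simp add: lookup_sum lookup_const)
    also have "\<dots> = (\<Sum>e\<in>F. c e * Poly_Mapping.lookup (Y e) a)"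
      unfolding E_def using finF by (intro sum.mono_neutral_left) auto
    also have "\<dots> = 0"
    proof (cases "a \<in> B")
      case False
      hence "Poly_Mapping.lookup (Y e) a = 0" if "e \<in> F" for e
        using keysY[OF that] by (auto simp: in_keys_iff)
      thus ?thesis by simp
    qed (rule c(2))
    finally show "Poly_Mapping.lookup (\<Sum>e\<in>E. Poly_Mapping.single 0 (c e) * Y e) a =
        Poly_Mapping.lookup 0 a" by simp
  qed
  moreover have "finite E" "E \<noteq> {}" using finF c(1) by (auto simp: E_def)
  moreover have "E \<subseteq> Pi\<^sub>E {..<k} (\<lambda>_. UNIV)" 
    using PiE_mono[of "{..<k}" "\<lambda>_. {..<m}" "\<lambda>_. UNIV"] unfolding E_def F_def by blast
  moreover have "\<forall>e\<in>E. c e \<noteq> 0" by (simp add: E_def)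
  ultimately show thesis unfolding Y_def by (intro that[of E c])
qed

text \<open>A polynomial relation among \<open>y 0, \<dots>, y (k - 1), s\<close> descends along a chain of primes. In the \<open>j\<close>-th step
  divide by the highest common power of \<open>y j\<close>, which is possible since \<open>y j\<close> is not in the prime \<open>C j\<close>;
  then the terms still divisible by \<open>y j\<close> vanish modulo \<open>C (Suc j)\<close>. The surviving terms no longer
  involve \<open>y j\<close>, and after \<open>k\<close> steps a polynomial in \<open>s\<close> alone remains. Injectivity on the remaining
  exponents ensures that no two terms have merged.\<close>

lemma prime_chain_relation:
  fixes C :: "nat \<Rightarrow> 'r::comm_ring_1 set"
  assumes prime: "\<And>i. i \<le> k \<Longrightarrow> primeideal (C i) ring_of_type_algebra"
    and chain: "\<And>i. i < k \<Longrightarrow> C i \<subseteq> C (Suc i)"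
    and y: "\<And>i. i < k \<Longrightarrow> y i \<in> C (Suc i) - C i"
    and E: "finite E" "E \<noteq> {}" "E \<subseteq> Pi\<^sub>E {..k} (\<lambda>_. UNIV)"
    and rel: "(\<Sum>e\<in>E. c e * ((\<Prod>i<k. y i ^ e i) * s ^ e k)) \<in> C 0"
  obtains E' where "E' \<noteq> {}" "E' \<subseteq> E" "inj_on (\<lambda>e. e k) E'" "(\<Sum>e\<in>E'. c e * s ^ e k) \<in> C k"
proof -
  define R where "R j e = (\<Prod>i\<in>{j..<k}. y i ^ e i) * s ^ e k" for j e
  have "\<exists>E'. E' \<noteq> {} \<and> E' \<subseteq> E \<and> inj_on (\<lambda>e. restrict e {j..k}) E' \<and> (\<Sum>e\<in>E'. c e * R j e) \<in> C j"
    if "j \<le> k" for j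
    using that
  proof (induction j)
    case 0
    have "inj_on (\<lambda>e. restrict e {0..k}) E"
    proof (rule inj_onI)
      fix e e' assume e: "e \<in> E" "e' \<in> E" "restrict e {0..k} = restrict e' {0..k}"
      show "e = e'"
        using e E(3) by (intro PiE_ext[of e "{..k}" "\<lambda>_. UNIV" e'])
          (auto dest: fun_cong[of "restrict e {0..k}"] simp: restrict_def split: if_splits, metis)
    qed
    moreover have "(\<Sum>e\<in>E. c e * R 0 e) \<in> C 0" using rel by (simp add: R_def lessThan_atLeast0)
    ultimately show ?case using E(2) by blast
  next
    case (Suc j)
    hence j: "j < k" "j \<le> k" by auto
    from Suc.IH[OF j(2)] obtain F where F: "F \<noteq> {}" "F \<subseteq> E" "inj_on (\<lambda>e. restrict e {j..k}) F"
      "(\<Sum>e\<in>F. c e * R j e) \<in> C j" by blast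
    have finF: "finite F" using F(2) E(1) by (rule finite_subset)
    define a where "a = Min ((\<lambda>e. e j) ` F)"
    have a: "a \<le> e j" if "e \<in> F" for e unfolding a_def using finF that by (intro Min_le) auto
    define F' where "F' = {e \<in> F. e j = a}"
    have "a \<in> (\<lambda>e. e j) ` F" unfolding a_def using finF F(1) by (intro Min_in) auto
    hence ne: "F' \<noteq> {}" by (auto simp: F'_def)
    note P = prime[OF j(2), unfolded primeideal_type_ring_iff]
    note Q = prime[OF Suc.prems, unfolded primeideal_type_ring_iff]
    have R_Suc: "R j e = y j ^ e j * R (Suc j) e" for e
      using j by (simp add: R_def prod.atLeast_Suc_lessThan mult.assoc)
    let ?T = "\<Sum>e\<in>F. c e * y j ^ (e j - a) * R (Suc j) e"
    have "(\<Sum>e\<in>F. c e * R j e) = y j ^ a * ?T"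
      unfolding sum_distrib_left
    proof (rule sum.cong[OF refl])
      fix e assume "e \<in> F"
      hence "y j ^ e j = y j ^ a * y j ^ (e j - a)" using a[of e] by (simp flip: power_add)
      thus "c e * R j e = y j ^ a * (c e * y j ^ (e j - a) * R (Suc j) e)"
        by (simp add: R_Suc mult_ac)
    qed
    hence "y j ^ a * ?T \<in> C j" using F(4) by simp
    moreover have "y j ^ n \<notin> C j" for n
    proof (induction n)
      case 0
      show ?case using P by simp
    next
      case (Suc n)
      moreover have "y j \<notin> C j" using y[OF j(1)] by blast
      ultimately show ?case using P unfolding power_Suc by blast
    qed
    ultimately have "?T \<in> C j" using P by blast
    hence T: "?T \<in> C (Suc j)" using chain[OF j(1)] by blast
    have T_split: "?T = (\<Sum>e\<in>F'. c e * y j ^ (e j - a) * R (Suc j) e) +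
        (\<Sum>e\<in>F - F'. c e * y j ^ (e j - a) * R (Suc j) e)"
      using finF by (subst sum.subset_diff[of F']) (simp_all add: F'_def add.commute)
    have "(\<Sum>e\<in>F - F'. c e * y j ^ (e j - a) * R (Suc j) e) \<in> C (Suc j)"
    proof (rule ideals.subspace_sum)
      fix e assume e: "e \<in> F - F'"
      hence "e j - a > 0" using a[of e] by (auto simp: F'_def)
      then obtain n where n: "e j - a = Suc n" by (metis gr0_conv_Suc)
      have "c e * y j ^ (e j - a) * R (Suc j) e = (c e * y j ^ n * R (Suc j) e) * y j"
        by (simp add: n mult_ac)
      also have "\<dots> \<in> C (Suc j)" using Q y[OF j(1)] by (intro ideals.subspace_scale) auto
      finally show "c e * y j ^ (e j - a) * R (Suc j) e \<in> C (Suc j)" .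
    qed (use Q in blast)
    from ideals.subspace_diff[OF _ T this] Q
    have "(\<Sum>e\<in>F'. c e * y j ^ (e j - a) * R (Suc j) e) \<in> C (Suc j)"
      unfolding T_split by simp
    also have "(\<Sum>e\<in>F'. c e * y j ^ (e j - a) * R (Suc j) e) = (\<Sum>e\<in>F'. c e * R (Suc j) e)"
      by (intro sum.cong) (auto simp: F'_def)
    finally have "(\<Sum>e\<in>F'. c e * R (Suc j) e) \<in> C (Suc j)" .
    moreover have "inj_on (\<lambda>e. restrict e {Suc j..k}) F'"
    proof (rule inj_onI)
      fix e e' assume e: "e \<in> F'" "e' \<in> F'" "restrict e {Suc j..k} = restrict e' {Suc j..k}"
      have "restrict e {j..k} = restrict e' {j..k}"
      proof
        fix i
        show "restrict e {j..k} i = restrict e' {j..k} i"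
          using e(1,2) fun_cong[OF e(3), of i]
          by (cases "i = j") (auto simp: F'_def restrict_def split: if_splits)
      qed
      thus "e = e'" using F(3) e(1,2) by (auto simp: F'_def dest: inj_onD)
    qed
    moreover have "F' \<subseteq> E" using F(2) by (auto simp: F'_def)
    ultimately show ?case using ne by blast
  qed
  from this[of k] obtain E' where E': "E' \<noteq> {}" "E' \<subseteq> E" "inj_on (\<lambda>e. restrict e {k..k}) E'"
    "(\<Sum>e\<in>E'. c e * R k e) \<in> C k" by blast
  have "inj_on (\<lambda>e. e k) E'"
  proof (rule inj_onI)
    fix e e' assume "e \<in> E'" "e' \<in> E'" "e k = e' k"
    moreover from this have "restrict e {k..k} = restrict e' {k..k}" by (auto simp: restrict_def)
    ultimately show "e = e'" using E'(3) by (auto dest: inj_onD)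
  qed
  thus thesis using that E' by (simp add: R_def)
qed

section \<open>The kernel of the Rees map\<close>

lemma ker_rees_iff: "P \<in> ker_rees f \<longleftrightarrow> rees_map f P = 0"
  by (simp add: ker_rees_def a_kernel_def kernel_def rees_algebra_def)

lemma rees_map_0 [simp]: "rees_map f 0 = 0"
  by (simp add: rees_map_def)

lemma rees_map_diff: "rees_map f (P - Q) = rees_map f P - rees_map f Q"
  using rees_map_add[of f "P - Q" Q] by (simp add: algebra_simps)

lemma rees_map_1: "rees_map f 1 = 1"
  by (simp add: rees_map_single flip: single_one)

lemma rees_map_power: "rees_map f (P ^ k) = rees_map f P ^ k"
  by (induction k) (simp_all add: rees_map_mult rees_map_1)

lemma primeideal_ker_rees: "primeideal (ker_rees f) ring_of_type_algebra"
  unfolding primeideal_type_ring_iff ideals.subspace_def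
  by (auto simp: ker_rees_iff rees_map_add rees_map_mult rees_map_1)

text \<open>A chain with more than \<open>n\<close> inclusions yields, with \<open>s\<close>, at least \<open>n + 2\<close> elements of a polynomial ring in
  \<open>n + 1\<close> variables. Their algebraic relation descends to a nonzero polynomial in \<open>s\<close> over \<open>\<O>\<close> in the kernel,
  but \<open>s\<close> is mapped to \<open>f t\<close>, which is transcendental over \<open>\<O>\<close>.\<close>

theorem prime_height_ker_rees:
  fixes f :: "('n::finite) cps"
  assumes f: "f \<noteq> 0"
  shows "prime_height ring_of_type_algebra (ker_rees f) \<le> enat (CARD('n))"
  unfolding prime_height_def
proof (rule Sup_least, clarify)
  fix k and C :: "nat \<Rightarrow> 'n xis_poly set"
  assume prime: "\<forall>i\<le>k. primeideal (C i) ring_of_type_algebra"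
    and chain: "\<forall>i<k. C i \<subset> C (Suc i)" and Ck: "C k = ker_rees f"
  have "\<forall>i<k. \<exists>y. y \<in> C (Suc i) - C i" using chain by blast
  then obtain y where y: "\<And>i. i < k \<Longrightarrow> y i \<in> C (Suc i) - C i" by metis
  show "enat k \<le> enat (CARD('n))"
  proof (rule ccontr)
    assume "\<not> ?thesis"
    hence "CARD('n option) < Suc k" by (simp add: card_option)
    then obtain E and c :: "(nat \<Rightarrow> nat) \<Rightarrow> 'n cps" where E: "finite E" "E \<noteq> {}" "E \<subseteq> Pi\<^sub>E {..<Suc k} (\<lambda>_. UNIV)"
      and c: "\<forall>e\<in>E. c e \<noteq> 0"
      and rel: "(\<Sum>e\<in>E. Poly_Mapping.single 0 (c e) * (\<Prod>i<Suc k. (y(k := Ps)) i ^ e i)) = 0"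
      by (rule algebraic_relation[of "Suc k" "y(k := Ps)"])
    have "(\<Sum>e\<in>E. PConst (c e) * ((\<Prod>i<k. y i ^ e i) * Ps ^ e k)) = 0"
      using rel by (simp add: PConst_def)
    moreover have "0 \<in> C 0" using prime by (auto simp: primeideal_type_ring_iff ideals.subspace_0)
    ultimately have rel': "(\<Sum>e\<in>E. PConst (c e) * ((\<Prod>i<k. y i ^ e i) * Ps ^ e k)) \<in> C 0" by simp
    obtain F where F: "F \<noteq> {}" "F \<subseteq> E" "inj_on (\<lambda>e. e k) F"
      "(\<Sum>e\<in>F. PConst (c e) * Ps ^ e k) \<in> C k"
    proof (rule prime_chain_relation[of k C y E "\<lambda>e. PConst (c e)" Ps])
      show "E \<subseteq> Pi\<^sub>E {..k} (\<lambda>_. UNIV)" using E(3) by (simp add: lessThan_Suc_atMost)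
    qed (use prime chain y E rel' in auto)
    have "0 = rees_map f (\<Sum>e\<in>F. PConst (c e) * Ps ^ e k)"
      using F(4) by (simp add: Ck ker_rees_iff)
    also have "\<dots> = (\<Sum>e\<in>F. monom (c e * f ^ e k) (e k))"
      by (simp add: rees_map_sum rees_map_mult rees_map_PConst rees_map_power rees_map_PVar
          monom_power smult_monom)
    finally have zero: "(\<Sum>e\<in>F. monom (c e * f ^ e k) (e k)) = 0" by simp
    obtain e where e: "e \<in> F" using F(1) by blast
    have finF: "finite F" using F(2) E(1) by (rule finite_subset)
    have "0 = (\<Sum>e'\<in>F. coeff (monom (c e' * f ^ e' k) (e' k)) (e k))"
      using arg_cong[OF zero, of "\<lambda>p. coeff p (e k)"] by (simp add: coeff_sum)
    also have "\<dots> = (\<Sum>e'\<in>F. if e' = e then c e' * f ^ e' k else 0)"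
      using F(3) e by (intro sum.cong) (auto dest: inj_onD)
    also have "\<dots> = c e * f ^ e k" using finF e by simp
    finally show False using c e F(2) f by auto
  qed
qed

section \<open>Derivations of convergent power series\<close>

lemma coeff_var_mult:
  "cps_coeff (cps_var j * p) a =
    (if Poly_Mapping.lookup a j > 0 then cps_coeff p (a - Poly_Mapping.single j 1) else 0)"
proof -
  have var: "cps_var j = cps_monom (Poly_Mapping.single j 1) 1"
    by (rule cps_eqI) (simp add: cps_var.rep_eq coeff_monom)
  show ?thesis
  proof (cases "Poly_Mapping.lookup a j > 0")
    case True
    hence "a = Poly_Mapping.single j 1 + (a - Poly_Mapping.single j 1)"
      by (intro poly_mapping_eqI) (auto simp: lookup_add lookup_minus lookup_single when_def)
    thus ?thesis
      using True coeff_monom_mult_plus[of "Poly_Mapping.single j 1" 1 p "a - Poly_Mapping.single j 1"]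
      by (simp add: var)
  next
    case False
    hence "\<nexists>x. a = Poly_Mapping.single j 1 + x" by (auto simp: lookup_add lookup_single)
    thus ?thesis using False by (simp add: var coeff_monom_mult_neq)
  qed
qed

lemma conv_series_le:
  assumes "conv_series d" "\<And>a. norm (c a) \<le> norm (d a)"
  shows "conv_series c"
proof -
  from conv_seriesE[OF assms(1)] obtain r B where
    r: "r > 0" "\<And>s F. 0 \<le> s \<Longrightarrow> s \<le> r \<Longrightarrow> finite F \<Longrightarrow> (\<Sum>a\<in>F. norm (d a) * s ^ mdeg a) \<le> B"
    by metis
  show ?thesis
  proof (rule conv_seriesI[of r])
    fix F :: "'a mexp set" assume "finite F"
    have "(\<Sum>a\<in>F. norm (c a) * r ^ mdeg a) \<le> (\<Sum>a\<in>F. norm (d a) * r ^ mdeg a)"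
      using r(1) assms(2) by (intro sum_mono mult_right_mono) auto
    also have "\<dots> \<le> B" using r \<open>finite F\<close> by auto
    finally show "(\<Sum>a\<in>F. norm (c a) * r ^ mdeg a) \<le> B" .
  qed (rule r)
qed

text \<open>Every monomial other than 1 is assigned to one of the variables that divide it. The coefficients of the
  resulting quotients are dominated by those of the partial derivatives, which gives convergence.\<close>

lemma Hadamard_decomposition:
  fixes g :: "('n::finite) cps"
  obtains g' where "g = cps_const (cps_coeff g 0) + (\<Sum>j\<in>UNIV. cps_var j * g' j)"
proof -
  have "\<exists>j. Poly_Mapping.lookup a j > 0" if "a \<noteq> 0" for a :: "'n mexp"
    using that by (metis lookup_zero not_gr_zero poly_mapping_eqI)
  then obtain \<iota> where \<iota>: "\<And>a :: 'n mexp. a \<noteq> 0 \<Longrightarrow> Poly_Mapping.lookup a (\<iota> a) > 0" by metis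
  define c where "c j b = (let a = b + Poly_Mapping.single j 1 in if \<iota> a = j then cps_coeff g a else 0)"
    for j b
  have "conv_series (c j)" for j
  proof (rule conv_series_le)
    show "conv_series (\<lambda>a. of_nat (Suc (Poly_Mapping.lookup a j)) * cps_coeff g (a + Poly_Mapping.single j 1))"
      using cps_coeff[of g] by (intro conv_series_deriv) simp
    show "norm (c j a) \<le> norm (of_nat (Suc (Poly_Mapping.lookup a j)) * cps_coeff g (a + Poly_Mapping.single j 1))" for a
    proof -
      have "1 * norm (cps_coeff g (a + Poly_Mapping.single j 1)) \<le>
          real (Suc (Poly_Mapping.lookup a j)) * norm (cps_coeff g (a + Poly_Mapping.single j 1))"
        by (intro mult_right_mono) auto
      thus ?thesis by (simp only: c_def Let_def norm_mult norm_of_nat) auto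
    qed
  qed
  hence c: "cps_coeff (Abs_cps (c j)) = c j" for j by (simp add: Abs_cps_inverse)
  show thesis
  proof (rule that, rule cps_eqI)
    fix a :: "'n mexp"
    have "(\<Sum>j\<in>UNIV. cps_coeff (cps_var j * Abs_cps (c j)) a) = (if a = 0 then 0 else cps_coeff g a)"
    proof (cases "a = 0")
      case False
      have "(\<Sum>j\<in>UNIV. cps_coeff (cps_var j * Abs_cps (c j)) a) =
          (\<Sum>j\<in>UNIV. if j = \<iota> a then cps_coeff g a else 0)"
      proof (rule sum.cong[OF refl])
        fix j
        have "a = a - Poly_Mapping.single j 1 + Poly_Mapping.single j 1" if "Poly_Mapping.lookup a j > 0"
          using that by (intro poly_mapping_eqI) (auto simp: lookup_add lookup_minus lookup_single when_def)
        thus "cps_coeff (cps_var j * Abs_cps (c j)) a = (if j = \<iota> a then cps_coeff g a else 0)"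
          using \<iota>[OF False] unfolding coeff_var_mult c c_def Let_def by auto
      qed
      thus ?thesis using False by simp
    qed (simp add: coeff_var_mult)
    thus "cps_coeff g a = cps_coeff (cps_const (cps_coeff g 0) + (\<Sum>j\<in>UNIV. cps_var j * Abs_cps (c j))) a"
      by (simp add: cps_coeff_sum cps_const.rep_eq)
  qed
qed

lemma derivation_0:
  assumes "is_derivation D"
  shows "D 0 = 0"
proof -
  have "D (0 + 0) = D 0 + D 0" using assms unfolding is_derivation_def by blast
  thus ?thesis by (metis add_0_right add_left_cancel)
qed

lemma derivation_sum:
  assumes "is_derivation D"
  shows "D (sum h A) = (\<Sum>x\<in>A. D (h x))"
  using assms
  by (induction A rule: infinite_finite_induct) (auto simp: derivation_0 is_derivation_def)

lemma derivation_const: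
  assumes "is_derivation D"
  shows "D (cps_const z) = 0"
proof -
  have "D (1 * 1) = 1 * D 1 + 1 * D 1" using assms unfolding is_derivation_def by blast
  hence "D 1 = 0" by (metis add_0_right add_left_cancel mult_1)
  moreover have "D (cps_const z * 1) = cps_const z * D 1"
    using assms unfolding is_derivation_def by blast
  ultimately show ?thesis by simp
qed

text \<open>Hadamard's decomposition gives \<open>D g = \<Sum>\<^sub>j x\<^sub>j D g\<^sub>j\<close>. Iterating it, \<open>D g\<close> vanishes to
  every order.\<close>

lemma derivation_eq_0:
  fixes D :: "('n::finite) cps \<Rightarrow> 'n cps"
  assumes D: "is_derivation D" and var: "\<And>j. D (cps_var j) = 0"
  shows "D g = 0"
proof -
  have "\<forall>g a. mdeg a < N \<longrightarrow> cps_coeff (D g) a = 0" for N :: nat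
  proof (induction N)
    case (Suc N)
    show ?case
    proof (intro allI impI)
      fix g :: "'n cps" and a :: "'n mexp"
      assume a: "mdeg a < Suc N"
      obtain g' where "g = cps_const (cps_coeff g 0) + (\<Sum>j\<in>UNIV. cps_var j * g' j)"
        by (rule Hadamard_decomposition)
      hence "D g = D (cps_const (cps_coeff g 0)) + (\<Sum>j\<in>UNIV. D (cps_var j * g' j))"
        using D by (metis derivation_sum[OF D] is_derivation_def)
      moreover have "D (cps_var j * g' j) = cps_var j * D (g' j)" for j
        using D var unfolding is_derivation_def by simp
      ultimately have Dg: "D g = (\<Sum>j\<in>UNIV. cps_var j * D (g' j))"
        by (simp add: derivation_const[OF D])
      have "cps_coeff (cps_var j * D (g' j)) a = 0" for j
      proof (cases "Poly_Mapping.lookup a j > 0")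
        case True
        hence "a = Poly_Mapping.single j 1 + (a - Poly_Mapping.single j 1)"
          by (intro poly_mapping_eqI) (auto simp: lookup_add lookup_minus lookup_single when_def)
        hence "mdeg a = 1 + mdeg (a - Poly_Mapping.single j 1)" by (metis mdeg_add mdeg_single)
        thus ?thesis using a Suc True by (simp add: coeff_var_mult)
      qed (simp add: coeff_var_mult)
      thus "cps_coeff (D g) a = 0" by (simp add: Dg cps_coeff_sum)
    qed
  qed simp
  thus ?thesis by (intro cps_eqI) (metis cps_coeff_0 lessI)
qed

text \<open>Half of the product rule: the terms in which the derivative falls on the first factor, indexed once
  before and once after the differentiation.\<close>

lemma sum_antidiag_shift:
  fixes f g :: "('n::finite) mexp \<Rightarrow> complex"
  defines "e \<equiv> \<lambda>j. Poly_Mapping.single j 1"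
  shows "(\<Sum>(b, c)\<in>antidiag (a + e j). of_nat (Poly_Mapping.lookup b j) * f b * g c) =
    (\<Sum>(b, c)\<in>antidiag a. of_nat (Suc (Poly_Mapping.lookup b j)) * f (b + e j) * g c)"
proof -
  let ?T = "\<lambda>(b, c). (b + e j, c)"
  have "(\<Sum>(b, c)\<in>antidiag (a + e j). of_nat (Poly_Mapping.lookup b j) * f b * g c) =
      (\<Sum>(b, c)\<in>?T ` antidiag a. of_nat (Poly_Mapping.lookup b j) * f b * g c)"
  proof (rule sum.mono_neutral_right[OF finite_antidiag])
    show "?T ` antidiag a \<subseteq> antidiag (a + e j)" by (auto simp: antidiag_def add_ac)
    show "\<forall>x\<in>antidiag (a + e j) - ?T ` antidiag a.
        (case x of (b, c) \<Rightarrow> of_nat (Poly_Mapping.lookup b j) * f b * g c) = 0"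
    proof (rule ballI, clarify)
      fix b c assume bc: "(b, c) \<in> antidiag (a + e j)" "(b, c) \<notin> ?T ` antidiag a"
      have "Poly_Mapping.lookup b j = 0"
      proof (rule ccontr)
        assume "Poly_Mapping.lookup b j \<noteq> 0"
        hence b: "b = (b - e j) + e j"
          by (intro poly_mapping_eqI)
            (auto simp: e_def lookup_add lookup_minus lookup_single when_def)
        hence "(b - e j) + c + e j = a + e j"
          using bc(1) by (simp add: antidiag_def add_ac)
        hence "(b - e j, c) \<in> antidiag a" by (simp add: antidiag_def)
        moreover have "(b, c) = ?T (b - e j, c)" using b by simp
        ultimately show False using bc(2) by (metis image_eqI)
      qed
      thus "of_nat (Poly_Mapping.lookup b j) * f b * g c = 0" by simp
    qed
  qed
  also have "\<dots> = (\<Sum>x\<in>antidiag a. (\<lambda>(b, c). of_nat (Poly_Mapping.lookup b j) * f b * g c) (?T x))"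
    by (rule sum.reindex[unfolded comp_def]) (auto simp: inj_on_def)
  also have "\<dots> = (\<Sum>(b, c)\<in>antidiag a. of_nat (Suc (Poly_Mapping.lookup b j)) * f (b + e j) * g c)"
    by (simp add: case_prod_unfold e_def lookup_add)
  finally show ?thesis .
qed

lemma sum_antidiag_swap:
  "(\<Sum>(b, c)\<in>antidiag a. h b c) = (\<Sum>(b, c)\<in>antidiag a. h c b)"
  by (rule sum.reindex_bij_witness[where i = prod.swap and j = prod.swap])
     (auto simp: antidiag_def add_ac)

lemma cps_deriv_mult: "cps_deriv j (f * g) = f * cps_deriv j g + g * cps_deriv j f"
proof (rule cps_eqI)
  fix a :: "'a mexp"
  let ?e = "Poly_Mapping.single j (1::nat)"
  let ?f = "cps_coeff f" and ?g = "cps_coeff g"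
  have deriv_mult: "cps_coeff (p * cps_deriv j q) a =
      (\<Sum>(b, c)\<in>antidiag (a + ?e). of_nat (Poly_Mapping.lookup b j) * cps_coeff q b * cps_coeff p c)" for p q
    unfolding cps_coeff_mult cps_deriv.rep_eq
    by (subst sum_antidiag_swap, subst sum_antidiag_shift) (simp add: mult_ac)
  have "cps_coeff (f * cps_deriv j g + g * cps_deriv j f) a =
      (\<Sum>(b, c)\<in>antidiag (a + ?e). of_nat (Poly_Mapping.lookup c j) * ?g c * ?f b) +
      (\<Sum>(b, c)\<in>antidiag (a + ?e). of_nat (Poly_Mapping.lookup b j) * ?f b * ?g c)"
    unfolding cps_coeff_add deriv_mult by (subst sum_antidiag_swap) simp
  also have "\<dots> = (\<Sum>(b, c)\<in>antidiag (a + ?e).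
      of_nat (Suc (Poly_Mapping.lookup a j)) * (?f b * ?g c))"
    unfolding case_prod_unfold sum.distrib[symmetric]
  proof (rule sum.cong[OF refl])
    fix x assume "x \<in> antidiag (a + ?e)"
    hence "fst x + snd x = a + ?e" by (auto simp: antidiag_def)
    hence "Poly_Mapping.lookup (fst x) j + Poly_Mapping.lookup (snd x) j = Suc (Poly_Mapping.lookup a j)"
      by (metis Suc_eq_plus1 lookup_add lookup_single_eq)
    hence "(of_nat (Suc (Poly_Mapping.lookup a j)) :: complex) =
        of_nat (Poly_Mapping.lookup (fst x) j) + of_nat (Poly_Mapping.lookup (snd x) j)"
      by (metis of_nat_add)
    thus "of_nat (Poly_Mapping.lookup (snd x) j) * ?g (snd x) * ?f (fst x) +
        of_nat (Poly_Mapping.lookup (fst x) j) * ?f (fst x) * ?g (snd x) =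
        of_nat (Suc (Poly_Mapping.lookup a j)) * (?f (fst x) * ?g (snd x))"
      by (simp only: algebra_simps)
  qed
  also have "\<dots> = cps_coeff (cps_deriv j (f * g)) a"
    by (simp add: cps_deriv.rep_eq cps_coeff_mult case_prod_unfold sum_distrib_left)
  finally show "cps_coeff (cps_deriv j (f * g)) a = cps_coeff (f * cps_deriv j g + g * cps_deriv j f) a"
    by simp
qed

lemma cps_deriv_add: "cps_deriv j (f + g) = cps_deriv j f + cps_deriv j g"
  by (rule cps_eqI) (simp add: cps_deriv.rep_eq distrib_left)

lemma coeff_const_mult:
  fixes g :: "('n::finite) cps"
  shows "cps_coeff (cps_const z * g) a = z * cps_coeff g a"
proof -
  have "(cps_const z :: 'n cps) = cps_monom 0 z" by (rule cps_eqI) (simp add: cps_const.rep_eq coeff_monom)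
  thus ?thesis using coeff_monom_mult_plus[of 0 z g a] by simp
qed

lemma cps_deriv_const_mult: "cps_deriv j (cps_const z * g) = cps_const z * cps_deriv j g"
  by (rule cps_eqI) (simp add: cps_deriv.rep_eq coeff_const_mult)

text \<open>The difference of the two sides is a derivation that vanishes on the coordinates.\<close>

theorem derivation_eq_sum_cps_deriv:
  fixes \<delta> :: "('n::finite) cps \<Rightarrow> 'n cps"
  assumes \<delta>: "is_derivation \<delta>"
  shows "\<delta> g = (\<Sum>j\<in>UNIV. \<delta> (cps_var j) * cps_deriv j g)"
proof -
  define D where "D g = \<delta> g - (\<Sum>j\<in>UNIV. \<delta> (cps_var j) * cps_deriv j g)" for g
  have "is_derivation D"
    unfolding is_derivation_def
  proof (intro conjI allI)
    fix g h :: "'n cps" and z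
    have "\<delta> (g + h) = \<delta> g + \<delta> h" using \<delta> unfolding is_derivation_def by blast
    thus "D (g + h) = D g + D h"
      by (simp add: D_def cps_deriv_add distrib_left sum.distrib)
    have "\<delta> (cps_const z * g) = cps_const z * \<delta> g" using \<delta> unfolding is_derivation_def by blast
    thus "D (cps_const z * g) = cps_const z * D g"
      by (simp add: D_def cps_deriv_const_mult right_diff_distrib sum_distrib_left mult.left_commute)
    have "\<delta> (g * h) = g * \<delta> h + h * \<delta> g" using \<delta> unfolding is_derivation_def by blast
    thus "D (g * h) = g * D h + h * D g"
      by (simp add: D_def cps_deriv_mult right_diff_distrib distrib_left sum.distrib
          sum_distrib_left mult.left_commute)
  qed
  moreover have "D (cps_var i) = 0" for i
    by (simp add: D_def cps_deriv_var if_distrib cong: if_cong)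
  ultimately have "D g = 0" by (rule derivation_eq_0)
  thus ?thesis by (simp add: D_def)
qed

section \<open>The ideal generated in degree one\<close>

lemma ker1_rees_eq_span: "ker1_rees f = ideals.span {P \<in> ker_rees f. homogeneous 1 P}"
  by (simp add: ker1_rees_def genideal_type_ring)

lemma subspace_ker_rees: "ideals.subspace (ker_rees f)"
  using primeideal_ker_rees[of f] by (simp add: primeideal_type_ring_iff)

lemma subspace_ker1_rees: "ideals.subspace (ker1_rees f)"
  by (simp add: ker1_rees_eq_span)

lemma ker1_rees_subset: "ker1_rees f \<subseteq> ker_rees f"
  unfolding ker1_rees_eq_span by (intro ideals.span_minimal subspace_ker_rees) auto

lemma homogeneous_diff:
  assumes "homogeneous d P" "homogeneous d Q"
  shows "homogeneous d (P - Q)"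
  unfolding homogeneous_def
proof
  fix a assume "a \<in> Poly_Mapping.keys (P - Q)"
  hence "a \<in> Poly_Mapping.keys P \<or> a \<in> Poly_Mapping.keys Q"
    by (cases "Poly_Mapping.lookup Q a = 0") (simp_all add: in_keys_iff lookup_minus)
  thus "mdeg a = d" using assms unfolding homogeneous_def by blast
qed

lemma homogeneous_sum:
  assumes "\<And>x. x \<in> A \<Longrightarrow> homogeneous d (h x)"
  shows "homogeneous d (sum h A)"
  unfolding homogeneous_def
proof
  fix a assume "a \<in> Poly_Mapping.keys (sum h A)"
  then obtain x where "x \<in> A" "a \<in> Poly_Mapping.keys (h x)"
    unfolding in_keys_iff lookup_sum by (meson sum.neutral)
  thus "mdeg a = d" using assms unfolding homogeneous_def by blast
qed

lemma homogeneous_linear_term: "homogeneous 1 (PConst a * PVar v)"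
  by (auto simp: homogeneous_def PConst_def PVar_def mult_single)

definition jacobian_gen :: "('n::finite) cps \<Rightarrow> 'n option \<Rightarrow> 'n cps" where
  "jacobian_gen f v = (case v of None \<Rightarrow> f | Some j \<Rightarrow> cps_deriv j f)"

lemma rees_gen_eq: "rees_gen f v = monom (jacobian_gen f v) 1"
  by (cases v) (simp_all add: jacobian_gen_def)

lemma rees_map_linear_term: "rees_map f (PConst a * PVar v) = monom (a * jacobian_gen f v) 1"
  by (simp add: rees_map_mult rees_map_PConst rees_map_PVar rees_gen_eq smult_monom)

text \<open>The image of \<open>\<sigma>(\<delta>)\<close> under \<open>\<phi>\<close> is \<open>\<Sum>\<^sub>j \<delta>(x\<^sub>j) \<partial>\<^sub>j(f) t = \<delta>(f) t\<close>, the same as that of \<open>\<alpha> s\<close>.\<close>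

lemma symbol_in_ker1_rees:
  assumes \<delta>: "is_derivation \<delta>" "\<delta> f = \<alpha> * f"
  shows "symbol \<delta> - PConst \<alpha> * Ps \<in> ker1_rees f"
  unfolding ker1_rees_eq_span
proof (intro ideals.span_base CollectI conjI)
  have "rees_map f (symbol \<delta>) = monom (\<Sum>j\<in>UNIV. \<delta> (cps_var j) * cps_deriv j f) 1"
    by (simp add: symbol_def rees_map_sum rees_map_linear_term jacobian_gen_def monom_sum)
  also have "\<dots> = rees_map f (PConst \<alpha> * Ps)"
    using derivation_eq_sum_cps_deriv[OF \<delta>(1), of f] \<delta>(2)
    by (simp add: rees_map_linear_term jacobian_gen_def)
  finally show "symbol \<delta> - PConst \<alpha> * Ps \<in> ker_rees f"
    by (simp add: ker_rees_iff rees_map_diff)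
  show "homogeneous 1 (symbol \<delta> - PConst \<alpha> * Ps)"
    unfolding symbol_def by (intro homogeneous_diff homogeneous_sum homogeneous_linear_term)
qed

lemma ideal_cong_mult:
  assumes I: "ideals.subspace I" and "x - x' \<in> I" "y - y' \<in> I"
  shows "x * y - x' * y' \<in> I"
proof -
  have "y * (x - x') + x' * (y - y') \<in> I"
    using assms by (intro ideals.subspace_add ideals.subspace_scale)
  thus ?thesis by (simp add: algebra_simps)
qed

lemma ideal_cong_power:
  assumes "ideals.subspace I" "x - x' \<in> I"
  shows "x ^ k - x' ^ k \<in> I"
proof (induction k)
  case 0
  show ?case using assms(1) by (simp add: ideals.subspace_0)
next
  case (Suc k)
  show ?case unfolding power_Suc by (rule ideal_cong_mult[OF assms Suc])
qed

lemma ideal_cong_prod: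
  assumes "ideals.subspace I" "\<And>i. h i - h' i \<in> I"
  shows "prod h A - prod h' A \<in> I"
proof (induction A rule: infinite_finite_induct)
  case (insert i A)
  show ?case unfolding prod.insert[OF insert.hyps]
    by (rule ideal_cong_mult[OF assms insert.IH])
qed (use assms(1) in \<open>simp_all add: ideals.subspace_0\<close>)

lemma PConst_mult: "PConst (a * b) = PConst a * PConst b"
  and PConst_1: "PConst 1 = 1"
  and PConst_sum: "PConst (sum h A) = (\<Sum>x\<in>A. PConst (h x))"
proof -
  show "PConst (a * b) = PConst a * PConst b" "PConst 1 = 1" by (simp_all add: PConst_def mult_single)
  show "PConst (sum h A) = (\<Sum>x\<in>A. PConst (h x))"
    by (induction A rule: infinite_finite_induct) (auto simp: PConst_def single_add)
qed

lemma PConst_power: "PConst (a ^ k) = PConst a ^ k"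
  by (induction k) (simp_all add: PConst_mult PConst_1)

lemma PConst_prod: "PConst (prod h A) = (\<Prod>x\<in>A. PConst (h x))"
  by (induction A rule: infinite_finite_induct) (simp_all add: PConst_mult PConst_1)

lemma single_eq_prod_PVar:
  fixes a :: "('n::finite) option mexp"
  shows "Poly_Mapping.single a z = PConst z * (\<Prod>v\<in>UNIV. PVar v ^ Poly_Mapping.lookup a v)"
proof -
  have power: "PVar v ^ k = Poly_Mapping.single (Poly_Mapping.single v k) 1" for v :: "'n option" and k
    by (induction k) (simp_all add: PVar_def mult_single flip: single_add)
  have "(\<Prod>v\<in>V. PVar v ^ Poly_Mapping.lookup a v) =
      Poly_Mapping.single (\<Sum>v\<in>V. Poly_Mapping.single v (Poly_Mapping.lookup a v)) 1" for V
    by (induction V rule: infinite_finite_induct) (simp_all add: power mult_single)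
  moreover have "(\<Sum>v\<in>UNIV. Poly_Mapping.single v (Poly_Mapping.lookup a v)) = a"
    by (rule poly_mapping_eqI) (simp add: lookup_sum lookup_single when_def)
  ultimately show ?thesis by (simp add: PConst_def mult_single)
qed

text \<open>Since \<open>f \<xi>\<^sub>j \<equiv> \<partial>\<^sub>j(f) s\<close> modulo the linear part, \<open>f\<^sup>N P\<close> is congruent to \<open>\<Sum>\<^sub>d f\<^bsup>N-d\<^esup> c\<^sub>d s\<^sup>d\<close>, where \<open>c\<^sub>d\<close> is
  the coefficient of \<open>t\<^sup>d\<close> in the image of \<open>P\<close>, which is zero.\<close>

lemma power_times_ker_rees:
  fixes f :: "('n::finite) cps"
  assumes P: "P \<in> ker_rees f" and N: "\<And>a. a \<in> Poly_Mapping.keys P \<Longrightarrow> mdeg a \<le> N"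
  shows "PConst (f ^ N) * P \<in> ker1_rees f"
proof -
  let ?K = "ker1_rees f"
  define G where "G a = (\<Prod>v\<in>UNIV. jacobian_gen f v ^ Poly_Mapping.lookup a v)" for a
  let ?p = "Poly_Mapping.lookup P" and ?A = "Poly_Mapping.keys P"
  have gen: "PConst f * PVar v - PConst (jacobian_gen f v) * Ps \<in> ?K" for v
    unfolding ker1_rees_eq_span
  proof (intro ideals.span_base CollectI conjI)
    show "PConst f * PVar v - PConst (jacobian_gen f v) * Ps \<in> ker_rees f"
      by (simp add: ker_rees_iff rees_map_diff rees_map_linear_term jacobian_gen_def)
  qed (intro homogeneous_diff homogeneous_linear_term)
  have monomial: "PConst (f ^ mdeg a) * Poly_Mapping.single a 1 - PConst (G a) * Ps ^ mdeg a \<in> ?K" for a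
  proof -
    have "(\<Prod>v\<in>UNIV. (PConst f * PVar v) ^ Poly_Mapping.lookup a v) -
        (\<Prod>v\<in>UNIV. (PConst (jacobian_gen f v) * Ps) ^ Poly_Mapping.lookup a v) \<in> ?K"
      by (intro ideal_cong_prod ideal_cong_power subspace_ker1_rees gen)
    thus ?thesis
      by (simp add: single_eq_prod_PVar[of a 1] PConst_1 power_mult_distrib prod.distrib mdeg_def
          power_sum PConst_power PConst_prod G_def)
  qed
  have "PConst (f ^ N) * P = (\<Sum>a\<in>?A. PConst (f ^ (N - mdeg a) * ?p a) * (PConst (f ^ mdeg a) * Poly_Mapping.single a 1))"
  proof -
    have "PConst (f ^ N) * P = (\<Sum>a\<in>?A. PConst (f ^ N) * Poly_Mapping.single a (?p a))"
      by (subst xis_poly_eq_sum[of P]) (rule sum_distrib_left)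
    also have "\<dots> = (\<Sum>a\<in>?A. PConst (f ^ (N - mdeg a) * ?p a) * (PConst (f ^ mdeg a) * Poly_Mapping.single a 1))"
    proof (rule sum.cong[OF refl])
      fix a assume "a \<in> ?A"
      hence "f ^ N = f ^ (N - mdeg a) * f ^ mdeg a" using N[of a] by (simp flip: power_add)
      thus "PConst (f ^ N) * Poly_Mapping.single a (?p a) =
          PConst (f ^ (N - mdeg a) * ?p a) * (PConst (f ^ mdeg a) * Poly_Mapping.single a 1)"
        by (simp add: PConst_def mult_single mult_ac)
    qed
    finally show ?thesis .
  qed
  moreover have "(\<Sum>a\<in>?A. PConst (f ^ (N - mdeg a) * ?p a) * (PConst (G a) * Ps ^ mdeg a)) = 0"
  proof -
    have "(\<Sum>a\<in>?A. PConst (f ^ (N - mdeg a) * ?p a) * (PConst (G a) * Ps ^ mdeg a)) =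
        (\<Sum>d\<le>N. \<Sum>a\<in>{a \<in> ?A. mdeg a = d}. PConst (f ^ (N - mdeg a) * ?p a) * (PConst (G a) * Ps ^ mdeg a))"
      using N by (intro sum.group[symmetric]) auto
    also have "\<dots> = (\<Sum>d\<le>N. PConst (f ^ (N - d) * coeff (rees_map f P) d) * Ps ^ d)"
    proof (rule sum.cong[OF refl])
      fix d
      have gens: "(\<Prod>v\<in>UNIV. rees_gen f v ^ Poly_Mapping.lookup a v) = monom (G a) (mdeg a)" for a
      proof -
        have "(\<Prod>v\<in>V. monom (h v) (k v)) = monom (prod h V) (sum k V)"
          for h :: "'n option \<Rightarrow> 'n cps" and k :: "'n option \<Rightarrow> nat" and V
          by (induction V rule: infinite_finite_induct) (simp_all add: mult_monom)
        thus ?thesis by (simp add: rees_gen_eq monom_power G_def mdeg_def)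
      qed
      have "coeff (rees_map f P) d = (\<Sum>a\<in>?A. if mdeg a = d then ?p a * G a else 0)"
        unfolding rees_map_def gens coeff_sum by (intro sum.cong) (simp_all add: smult_monom)
      also have "\<dots> = (\<Sum>a\<in>{a \<in> ?A. mdeg a = d}. ?p a * G a)"
        by (intro sum.inter_filter[symmetric]) simp
      finally have coeff: "coeff (rees_map f P) d = (\<Sum>a\<in>{a \<in> ?A. mdeg a = d}. ?p a * G a)" .
      show "(\<Sum>a\<in>{a \<in> ?A. mdeg a = d}. PConst (f ^ (N - mdeg a) * ?p a) * (PConst (G a) * Ps ^ mdeg a)) =
          PConst (f ^ (N - d) * coeff (rees_map f P) d) * Ps ^ d"
        unfolding coeff sum_distrib_left PConst_sum sum_distrib_right
        by (intro sum.cong) (auto simp: PConst_mult mult_ac)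
    qed
    also have "\<dots> = 0" using P by (simp add: ker_rees_iff PConst_def)
    finally show ?thesis .
  qed
  ultimately have "PConst (f ^ N) * P = (\<Sum>a\<in>?A. PConst (f ^ (N - mdeg a) * ?p a) *
      (PConst (f ^ mdeg a) * Poly_Mapping.single a 1 - PConst (G a) * Ps ^ mdeg a))"
    by (simp add: right_diff_distrib sum_subtractf)
  also have "\<dots> \<in> ?K"
    by (intro ideals.subspace_sum[OF subspace_ker1_rees] ideals.subspace_scale[OF subspace_ker1_rees] monomial)
  finally show ?thesis .
qed

lemma noetherian_xis_poly: "noetherian TYPE(('n::finite) xis_poly)"
  by (rule noetherian_poly_mapping[OF noetherian_cps])

text \<open>Finitely many generators of the kernel have bounded degree, so a single power of \<open>f\<close> moves the whole
  kernel into the ideal of its linear part. The converse inclusion holds because \<open>f\<^sup>N\<close> is not a zero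
  divisor in the Rees algebra.\<close>

lemma ker_rees_colon:
  fixes f :: "('n::finite) cps"
  assumes "f \<noteq> 0"
  obtains N where "ker_rees f = {P. P * PConst (f ^ N) \<in> ker1_rees f}"
proof -
  obtain B where B: "finite B" "ideals.span B = ker_rees f"
    using noetherian_xis_poly subspace_ker_rees unfolding noetherian_def by blast
  define N where "N = Max (insert 0 (mdeg ` (\<Union>P\<in>B. Poly_Mapping.keys P)))"
  have N: "mdeg a \<le> N" if "P \<in> B" "a \<in> Poly_Mapping.keys P" for P a
    unfolding N_def using that B(1) by (intro Max_ge) auto
  define J where "J = {P. P * PConst (f ^ N) \<in> ker1_rees f}"
  have J: "ideals.subspace J"
  proof (rule ideals.subspaceI)
    show "0 \<in> J" by (simp add: J_def ideals.subspace_0[OF subspace_ker1_rees])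
    show "x + y \<in> J" if "x \<in> J" "y \<in> J" for x y
      using that ideals.subspace_add[OF subspace_ker1_rees] by (simp add: J_def distrib_right)
    show "c * x \<in> J" if "x \<in> J" for c x
      using that ideals.subspace_scale[OF subspace_ker1_rees] by (simp add: J_def mult.assoc)
  qed
  have "ker_rees f \<subseteq> J"
    unfolding B(2)[symmetric]
  proof (rule ideals.span_minimal[OF _ J], rule subsetI)
    fix P assume "P \<in> B"
    moreover from this have "P \<in> ker_rees f" using B(2) ideals.span_base by blast
    ultimately show "P \<in> J"
      using power_times_ker_rees[of P f N] N by (simp add: J_def mult.commute)
  qed
  moreover have "J \<subseteq> ker_rees f"
  proof
    fix P assume "P \<in> J"
    hence "P * PConst (f ^ N) \<in> ker_rees f" using ker1_rees_subset by (auto simp: J_def)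
    hence "rees_map f P * [:f ^ N:] = 0" by (simp add: ker_rees_iff rees_map_mult rees_map_PConst)
    thus "P \<in> ker_rees f" using assms by (simp add: ker_rees_iff)
  qed
  ultimately show thesis using that unfolding J_def by blast
qed

section \<open>Comparison of heights\<close>

theorem proposition4p16:
  fixes f :: "('n::finite) cps"
  assumes "reduced_equation f"
    and "strongly_Saito_holonomic f"
    and "unmixed (ring_of_type_algebra :: 'n xis_poly ring) (ker1_rees f)"
  shows "linear_Jacobian_type f"
proof -
  let ?R = "ring_of_type_algebra :: 'n xis_poly ring"
  have f: "f \<noteq> 0" using assms(1) by (simp add: reduced_equation_def)
  obtain N where N: "ker_rees f = {P. P * PConst (f ^ N) \<in> ker1_rees f}"
    using ker_rees_colon[OF f] .
  have "ker_rees f \<in> associated_primes ?R (ker1_rees f)"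
    unfolding associated_primes_def using primeideal_ker_rees[of f] N by auto
  have "ker_rees f \<subseteq> ker1_rees f"
  proof (rule ccontr)
    assume "\<not> ?thesis"
    then obtain P where P: "P \<in> ker_rees f" "P \<notin> ker1_rees f" by blast
    \<comment> \<open>The power of \<open>f\<close> just before \<open>P\<close> enters the ideal gives an element that \<open>f\<close> annihilates modulo it.\<close>
    let ?Q = "\<lambda>k. PConst f ^ k * P \<in> ker1_rees f"
    have "?Q N" using P(1) N by (simp add: mult.commute PConst_power)
    moreover have "\<not> ?Q 0" using P(2) by simp
    ultimately obtain k where k: "\<not> ?Q k" "?Q (Suc k)"
      using ex_least_nat_less[of ?Q N] by blast
    have "PConst f * (PConst f ^ k * P) \<in> ker1_rees f" using k(2) by (simp add: mult.assoc)
    from ex_associated_prime[OF noetherian_xis_poly subspace_ker1_rees k(1) this] obtain Q where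
      Q: "Q \<in> associated_primes ?R (ker1_rees f)" "ker1_rees f \<subseteq> Q" "PConst f \<in> Q" by blast
    obtain m \<delta> \<alpha> where gen: "generates_log_derivations f m \<delta>" "\<forall>i<m. \<delta> i f = \<alpha> i * f"
      and height: "ideal_height ?R (Idl\<^bsub>?R\<^esub>
        (insert (PConst f) ((\<lambda>i. symbol (\<delta> i) - PConst (\<alpha> i) * Ps) ` {..<m}))) = enat (CARD('n) + 1)"
      using assms(2) unfolding strongly_Saito_holonomic_def by blast
    let ?I = "Idl\<^bsub>?R\<^esub> (insert (PConst f) ((\<lambda>i. symbol (\<delta> i) - PConst (\<alpha> i) * Ps) ` {..<m}))"
    have "?I \<subseteq> Q"
      unfolding genideal_type_ring
    proof (rule ideals.span_minimal)
      have "symbol (\<delta> i) - PConst (\<alpha> i) * Ps \<in> ker1_rees f" if "i < m" for i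
        using gen that by (intro symbol_in_ker1_rees)
          (auto simp: generates_log_derivations_def log_derivations_def)
      thus "insert (PConst f) ((\<lambda>i. symbol (\<delta> i) - PConst (\<alpha> i) * Ps) ` {..<m}) \<subseteq> Q"
        using Q by auto
      show "ideals.subspace Q"
        using Q(1) by (simp add: associated_primes_def primeideal_type_ring_iff)
    qed
    hence "ideal_height ?R ?I \<le> ideal_height ?R Q"
      unfolding ideal_height_def by (intro Inf_superset_mono) blast
    also have "\<dots> = ideal_height ?R (ker_rees f)"
      using assms(3) Q(1) \<open>ker_rees f \<in> associated_primes ?R (ker1_rees f)\<close>
      unfolding unmixed_def by blast
    also have "\<dots> \<le> prime_height ?R (ker_rees f)"
      unfolding ideal_height_def using primeideal_ker_rees[of f] by (intro Inf_lower) blast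
    also have "\<dots> \<le> enat (CARD('n))" by (rule prime_height_ker_rees[OF f])
    finally show False unfolding height by simp
  qed
  thus ?thesis unfolding linear_Jacobian_type_def using ker1_rees_subset by blast
qed

end
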